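(* Let $0<\epsilon\le\theta+R_g$, and let $(\delta_t)$ be a non-negative sequence such that $\delta_t\le\epsilon/2+\min_{\tau<t}G_\tau^a$ for all $t$. Let $$K_r=\lfloor 10.6\,\Delta_0\rfloor,\qquad K_s=\left\lceil\frac{72(\theta+R_g)^2}{\epsilon}\right\rceil,\qquad K_q=2+\left\lceil\log_2\left(\frac{\theta+R_g}{\epsilon}\right)\right\rceil .$$ Then, for the Approximate Generalized Frank-Wolfe algorithm applied to $\min_x F(x)$ with oracle accuracies $(\delta_t)$, there exists some $K\le K_r+2K_s+K_q$ such that $\Delta_K\le 5\epsilon/2$, $G_K^a\le\epsilon$ and $\delta_K\le 3\epsilon/2$.
   Context: Setting. $\mathcal{K}\subset\mathbb{R}^d$ is a proper cone (closed, convex, pointed, nonempty interior). $f$ is a 2-self-concordant, $\theta$-logarithmically-homogeneous barrier on $\mathrm{int}(\mathcal{K})$: $f$ is strictly convex and $C^3$ on $\mathrm{int}(\mathcal{K})$; $f(w_i)\to\infty$ along every sequence in $\mathrm{int}(\mathcal{K})$ converging to a boundary point of $\mathcal{K}$; $|\nabla^3 f(w)[u,u,u]|\le 2(u^T\nabla^2 f(w)u)^{3/2}$ for all $w\in\mathrm{int}(\mathcal{K})$, $u\in\mathbb{R}^d$; and $f(cw)=f(w)-\theta\log c$ for $w\in\mathrm{int}(\mathcal{K})$, $c>0$. $\mathcal{B}:\mathbb{R}^n\to\mathbb{R}^d$ is linear with adjoint $\mathcal{B}^*$. $g$ is a proper, closed, convex (possibly nonsmooth) function with compact domain, and $\mathrm{int}(\mathcal{K})\cap\mathcal{B}(\mathrm{dom}(g))\ne\emptyset$.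 $R_g=\max_{x_1,x_2\in\mathrm{dom}(g)}|g(x_1)-g(x_2)|$ (assumed finite). $F(x)=f(\mathcal{B}(x))+g(x)$; a point $x$ is feasible if $x\in\mathrm{dom}(g)$ and $\mathcal{B}(x)\in\mathrm{int}(\mathcal{K})$; $x^\star$ is a minimizer of $F$. Notation. $F^{\mathrm{lin}}_{x}(h)=\langle\mathcal{B}^*(\nabla f(\mathcal{B}(x))),h\rangle+g(h)$, and $h^\star$ is a minimizer of $F^{\mathrm{lin}}_{x^t}$ over $\mathbb{R}^n$. $\|w\|_u=\sqrt{\langle w,\nabla^2 f(u)w\rangle}$. $\Delta_t=F(x^t)-F(x^\star)$; $G_t^a=F^{\mathrm{lin}}_{x^t}(x^t)-F^{\mathrm{lin}}_{x^t}(h^t)$ (approximate duality gap); $D_t=\|\mathcal{B}(h^t-x^t)\|_{\mathcal{B}(x^t)}$. A minimum over an empty set is $+\infty$. Oracle ILMO. Given $x^t$, $\mathcal{B}^*(\nabla f(\mathcal{B}(x^t)))$ and $\delta_t\ge0$, it returns $(h^t,G_t^a)$ with $h^t\in\mathrm{dom}(g)$, $\mathcal{B}(h^t)\in\mathcal{K}$, $G_t^a\ge 0$, and at least one of: (large gap) $G_t^a>\theta+R_g$; ($\delta_t$-suboptimality) $F^{\mathrm{lin}}_{x^t}(h^t)\le F^{\mathrm{lin}}_{x^t}(h^\star)+\delta_t$. Approximate Generalized Frank-Wolfe algorithm. Start from a feasible $x^0$. For $t=0,1,2,\dots$: choose $\delta_t\ge 0$; obtain $(h^t,G_t^a)$ from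 ILMO with accuracy $\delta_t$; if $G_t^a\le\epsilon$ and $\delta_t\le 3\epsilon/2$, stop and return $x^t$; otherwise set $\gamma_t=\min\{G_t^a/(D_t(D_t+G_t^a)),1\}$ (with $\gamma_t=1$ if $D_t=0<G_t^a$ and $\gamma_t=0$ if $D_t=G_t^a=0$) and $x^{t+1}=(1-\gamma_t)x^t+\gamma_t h^t$. *)

theory Defs
  imports "HOL-Analysis.Analysis"
begin

definition proper_cone :: "'a::euclidean_space set \<Rightarrow> bool" where
  "proper_cone C \<longleftrightarrow>
     cone C \<and> closed C \<and> convex C \<and> (\<forall>x. x \<in> C \<and> - x \<in> C \<longrightarrow> x = 0) \<and> interior C \<noteq> {}"

text \<open>The class \<open>C\<^sup>k\<close> on an open set, through iterated directional derivatives;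
  the dimension is finite, so this is the usual notion.\<close>

primrec C_k_on :: "nat \<Rightarrow> 'a::euclidean_space set \<Rightarrow> ('a \<Rightarrow> real) \<Rightarrow> bool" where
  "C_k_on 0 S f \<longleftrightarrow> continuous_on S f"
| "C_k_on (Suc k) S f \<longleftrightarrow>
     (\<forall>x\<in>S. f differentiable (at x)) \<and> (\<forall>v. C_k_on k S (\<lambda>x. frechet_derivative f (at x) v))"

definition gradient :: "('a::euclidean_space \<Rightarrow> real) \<Rightarrow> 'a \<Rightarrow> 'a" where
  "gradient f w = (THE D. GDERIV f w :> D)"

text \<open>The Hessian at \<open>w\<close> is the linear map \<open>u \<mapsto> \<nabla>\<^sup>2f(w) u\<close>, and
  \<open>third_derivative f w u v\<close> is the vector \<open>\<nabla>\<^sup>3f(w)[u,v,\<cdot>]\<close>.\<close>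

definition hessian :: "('a::euclidean_space \<Rightarrow> real) \<Rightarrow> 'a \<Rightarrow> 'a \<Rightarrow> 'a" where
  "hessian f w = frechet_derivative (gradient f) (at w)"

definition third_derivative :: "('a::euclidean_space \<Rightarrow> real) \<Rightarrow> 'a \<Rightarrow> 'a \<Rightarrow> 'a \<Rightarrow> 'a" where
  "third_derivative f w u v = frechet_derivative (\<lambda>y. hessian f y u) (at w) v"

definition local_norm :: "('a::euclidean_space \<Rightarrow> real) \<Rightarrow> 'a \<Rightarrow> 'a \<Rightarrow> real" where
  "local_norm f u w = sqrt (w \<bullet> hessian f u w)"

definition strictly_convex_on :: "'a::real_vector set \<Rightarrow> ('a \<Rightarrow> real) \<Rightarrow> bool" where
  "strictly_convex_on S f \<longleftrightarrow> convex S \<and>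
     (\<forall>x\<in>S. \<forall>y\<in>S. \<forall>t. x \<noteq> y \<and> 0 < t \<and> t < 1 \<longrightarrow>
        f ((1 - t) *\<^sub>R x + t *\<^sub>R y) < (1 - t) * f x + t * f y)"

text \<open>Only the values of \<open>f\<close> on \<open>interior C\<close> matter.\<close>

definition sc_log_homogeneous_barrier ::
    "'a::euclidean_space set \<Rightarrow> real \<Rightarrow> ('a \<Rightarrow> real) \<Rightarrow> bool" where
  "sc_log_homogeneous_barrier C \<theta> f \<longleftrightarrow>
     strictly_convex_on (interior C) f \<and>
     C_k_on 3 (interior C) f \<and>
     (\<forall>w z. (\<forall>i. w i \<in> interior C) \<and> z \<in> frontier C \<and> w \<longlonglongrightarrow> z \<longrightarrow>
        filterlim (\<lambda>i. f (w i)) at_top sequentially) \<and>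
     (\<forall>w\<in>interior C. \<forall>u.
        \<bar>u \<bullet> third_derivative f w u u\<bar> \<le> 2 * (u \<bullet> hessian f w u) powr (3 / 2)) \<and>
     (\<forall>w\<in>interior C. \<forall>c>0. f (c *\<^sub>R w) = f w - \<theta> * ln c)"

definition edom :: "('a \<Rightarrow> ereal) \<Rightarrow> 'a set" where
  "edom g = {x. g x < \<infinity>}"

definition proper_fun :: "('a \<Rightarrow> ereal) \<Rightarrow> bool" where
  "proper_fun g \<longleftrightarrow> (\<forall>x. g x \<noteq> - \<infinity>) \<and> edom g \<noteq> {}"

definition eepigraph :: "('a \<Rightarrow> ereal) \<Rightarrow> ('a \<times> real) set" where
  "eepigraph g = {(x, r). g x \<le> ereal r}"

definition closed_fun :: "('a::topological_space \<Rightarrow> ereal) \<Rightarrow> bool" where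
  "closed_fun g \<longleftrightarrow> closed (eepigraph g)"

definition convex_fun :: "('a::real_vector \<Rightarrow> ereal) \<Rightarrow> bool" where
  "convex_fun g \<longleftrightarrow> convex (eepigraph g)"

text \<open>The oscillation of \<open>g\<close> over its domain. It is a supremum, since a closed convex
  function that is bounded on a compact domain need not attain its maximum there.\<close>

definition osc :: "('a \<Rightarrow> ereal) \<Rightarrow> ereal" where
  "osc g = (SUP x1\<in>edom g. SUP x2\<in>edom g. \<bar>g x1 - g x2\<bar>)"

definition feasible ::
    "'b::euclidean_space set \<Rightarrow> ('a::euclidean_space \<Rightarrow> 'b) \<Rightarrow> ('a \<Rightarrow> ereal) \<Rightarrow> 'a \<Rightarrow> bool" where
  "feasible C B g x \<longleftrightarrow> x \<in> edom g \<and> B x \<in> interior C"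

text \<open>The barrier takes the value \<open>\<infinity>\<close> outside \<open>interior C\<close>.\<close>

definition objective :: "'b::euclidean_space set \<Rightarrow> ('b \<Rightarrow> real) \<Rightarrow> ('a::euclidean_space \<Rightarrow> 'b) \<Rightarrow>
    ('a \<Rightarrow> ereal) \<Rightarrow> 'a \<Rightarrow> ereal" where
  "objective C f B g x = (if B x \<in> interior C then ereal (f (B x)) else \<infinity>) + g x"

definition lin_objective :: "('b::euclidean_space \<Rightarrow> real) \<Rightarrow> ('a::euclidean_space \<Rightarrow> 'b) \<Rightarrow>
    ('a \<Rightarrow> ereal) \<Rightarrow> 'a \<Rightarrow> 'a \<Rightarrow> ereal" where
  "lin_objective f B g x h = ereal (adjoint B (gradient f (B x)) \<bullet> h) + g h"

text \<open>\<open>ilmo C f \<theta> B g R x \<delta> h G\<close>: at the iterate \<open>x\<close>, with accuracy \<open>\<delta>\<close>, the oracle may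
  return the pair \<open>(h, G)\<close>.\<close>

definition ilmo :: "'b::euclidean_space set \<Rightarrow> ('b \<Rightarrow> real) \<Rightarrow> real \<Rightarrow>
    ('a::euclidean_space \<Rightarrow> 'b) \<Rightarrow> ('a \<Rightarrow> ereal) \<Rightarrow> real \<Rightarrow> 'a \<Rightarrow> real \<Rightarrow> 'a \<Rightarrow> real \<Rightarrow> bool" where
  "ilmo C f \<theta> B g R x \<delta> h G \<longleftrightarrow>
     h \<in> edom g \<and> B h \<in> C \<and>
     ereal G = lin_objective f B g x x - lin_objective f B g x h \<and> 0 \<le> G \<and>
     (G > \<theta> + R \<or>
      (\<exists>hs. is_arg_min (lin_objective f B g x) (\<lambda>_. True) hs \<and>
            lin_objective f B g x h \<le> lin_objective f B g x hs + ereal \<delta>))"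

definition step_size :: "real \<Rightarrow> real \<Rightarrow> real" where
  "step_size G D =
     (if D = 0 then (if 0 < G then 1 else 0) else min (G / (D * (D + G))) 1)"

definition stop_test :: "real \<Rightarrow> real \<Rightarrow> real \<Rightarrow> bool" where
  "stop_test \<epsilon> G \<delta> \<longleftrightarrow> G \<le> \<epsilon> \<and> \<delta> \<le> 3 * \<epsilon> / 2"

text \<open>Iteration \<open>t\<close> is executed iff the algorithm has not stopped at an earlier iteration.\<close>

definition executed :: "real \<Rightarrow> (nat \<Rightarrow> real) \<Rightarrow> (nat \<Rightarrow> real) \<Rightarrow> nat \<Rightarrow> bool" where
  "executed \<epsilon> G \<delta> t \<longleftrightarrow> (\<forall>s<t. \<not> stop_test \<epsilon> (G s) (\<delta> s))"

text \<open>The sequences are unconstrained beyond the iteration at which the algorithm stops.\<close>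

definition agfw_run :: "'b::euclidean_space set \<Rightarrow> ('b \<Rightarrow> real) \<Rightarrow> real \<Rightarrow>
    ('a::euclidean_space \<Rightarrow> 'b) \<Rightarrow> ('a \<Rightarrow> ereal) \<Rightarrow> real \<Rightarrow> real \<Rightarrow> (nat \<Rightarrow> real) \<Rightarrow>
    (nat \<Rightarrow> 'a) \<Rightarrow> (nat \<Rightarrow> 'a) \<Rightarrow> (nat \<Rightarrow> real) \<Rightarrow> bool" where
  "agfw_run C f \<theta> B g R \<epsilon> \<delta> x h G \<longleftrightarrow>
     feasible C B g (x 0) \<and>
     (\<forall>t. executed \<epsilon> G \<delta> t \<longrightarrow>
        ilmo C f \<theta> B g R (x t) (\<delta> t) (h t) (G t) \<and>
        (\<not> stop_test \<epsilon> (G t) (\<delta> t) \<longrightarrow>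
           (let \<gamma> = step_size (G t) (local_norm f (B (x t)) (B (h t - x t)))
            in x (Suc t) = (1 - \<gamma>) *\<^sub>R x t + \<gamma> *\<^sub>R h t)))"

end

theory Submission
  imports Defs
begin

text \<open>Put \<open>M = \<theta> + R\<close>. Homogeneity gives \<open>\<nabla>\<^sup>2f(w) w = - \<nabla>f(w)\<close>, and self-concordance along the rays
  \<open>w + t v\<close> gives \<open>\<parallel>v\<parallel>\<^sub>w \<le> - \<langle>\<nabla>f(w), v\<rangle>\<close> for \<open>v\<close> in the cone; together they bound \<open>D\<^sub>t\<close> by
  \<open>G\<^sub>t + M\<close>. The self-concordant upper bound on \<open>f\<close> then shows that an iteration lowers \<open>F\<close> by at
  least \<open>1/2 - ln (3/2) \<ge> 1/10.6\<close> if \<open>G\<^sub>t > M\<close>, and by at least \<open>G\<^sub>t\<^sup>2 / (12 M\<^sup>2)\<close> otherwise.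

  An iteration that does not stop is of one of five kinds. Those with \<open>G\<^sub>t > M\<close> are paid for by
  \<open>10.6 \<Delta>\<^sub>0\<close>. There is at most one that is the first with \<open>G\<^sub>t \<le> M\<close>, and at most one with
  \<open>G\<^sub>t \<le> \<epsilon>\<close>, because afterwards \<open>\<delta>\<^sub>t \<le> 3\<epsilon>/2\<close>. Those that halve the running minimum of the gaps number
  at most \<open>log\<^sub>2 (M/\<epsilon>)\<close>. In the remaining ones the running minimum is below \<open>2 G\<^sub>t\<close>, hence
  \<open>\<Delta>\<^sub>t \<le> G\<^sub>t + \<delta>\<^sub>t \<le> 7/2 G\<^sub>t\<close>, so that \<open>\<Delta>\<close> drops by at least \<open>max (\<epsilon>\<^sup>2) ((2\<Delta>\<^sub>t/7)\<^sup>2) / (12 M\<^sup>2)\<close>; a concave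
  potential of \<open>\<Delta>\<close> shows that there are at most \<open>84 M\<^sup>2/\<epsilon>\<close> of them. The difference to
  \<open>144 M\<^sup>2/\<epsilon>\<close> absorbs the rounding.\<close>

section \<open>Counting iterations\<close>

text \<open>The source of the constant 10.6: \<open>43 / 106\<close> equals
  \<open>1 / 2 - 1 / 10.6\<close>.\<close>

lemma ln_three_halves_le: "ln (3 / 2 :: real) \<le> 43 / 106"
proof -
  \<comment> \<open>One sixteenth of \<open>43 / 106\<close>: for so small an exponent the quadratic
    Taylor polynomial of \<open>exp\<close>, raised to the 16th power, already exceeds 3/2.\<close>
  define a :: real where "a = 43 / 1696"
  have "(3 / 2 :: real) \<le> (1 + a + a\<^sup>2 / 2) ^ 16"
    by (simp add: a_def power2_eq_square field_simps)
  also have "\<dots> \<le> exp a ^ 16"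
    by (intro power_mono exp_lower_Taylor_quadratic) (auto simp: a_def)
  also have "\<dots> = exp (43 / 106)"
    by (simp add: a_def flip: exp_of_nat_mult)
  finally have "ln (3 / 2 :: real) \<le> ln (exp (43 / 106))"
    by (subst ln_le_cancel_iff) auto
  then show ?thesis by simp
qed

lemma minus_ln_one_plus_mono:
  fixes s t :: real
  assumes "0 \<le> s" "s \<le> t"
  shows "s - ln (1 + s) \<le> t - ln (1 + t)"
proof -
  have "ln (1 + t) - ln (1 + s) = ln ((1 + t) / (1 + s))"
    using assms by (simp add: ln_div)
  also have "\<dots> \<le> (1 + t) / (1 + s) - 1"
    using assms by (intro ln_le_minus_one) auto
  also have "\<dots> = (t - s) / (1 + s)"
    using assms by (simp add: field_simps)
  also have "\<dots> \<le> t - s"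
    using assms divide_left_mono[of 1 "1 + s" "t - s"] by simp
  finally show ?thesis by simp
qed

text \<open>The derivative of the difference is \<open>r * (1 - 2 * r) / (3 * (1 + r))\<close>,
  whose sign changes at 1/2; this ties the factor 1/3 to the range.\<close>

lemma minus_ln_one_plus_ge:
  fixes s :: real
  assumes "0 \<le> s" "s \<le> 1 / 2"
  shows "s\<^sup>2 / 3 \<le> s - ln (1 + s)"
proof -
  let ?k = "\<lambda>s::real. s - s\<^sup>2 / 3 - ln (1 + s)"
  have "?k 0 \<le> ?k s"
  proof (rule DERIV_nonneg_imp_nondecreasing[OF assms(1)])
    fix r :: real assume r: "0 \<le> r" "r \<le> s"
    have "(?k has_real_derivative 1 - 2 * r / 3 - 1 / (1 + r)) (at r)"
      using r by (auto intro!: derivative_eq_intros)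
    moreover have "1 - 2 * r / 3 - 1 / (1 + r) = r * (1 - 2 * r) / (3 * (1 + r))"
      using r by (simp add: field_simps)
    moreover have "0 \<le> r * (1 - 2 * r) / (3 * (1 + r))"
      using r assms by simp
    ultimately show "\<exists>y. (?k has_real_derivative y) (at r) \<and> 0 \<le> y"
      by metis
  qed
  then show ?thesis by simp
qed

lemma minus_ln_one_minus_le:
  fixes s :: real
  assumes "0 \<le> s" "s < 1"
  shows "- s - ln (1 - s) \<le> s\<^sup>2 / (2 * (1 - s))"
proof -
  let ?k = "\<lambda>s::real. s\<^sup>2 / (2 * (1 - s)) + s + ln (1 - s)"
  have "?k 0 \<le> ?k s"
  proof (rule DERIV_nonneg_imp_nondecreasing[OF assms(1)])
    fix r :: real assume r: "0 \<le> r" "r \<le> s"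
    then have "r < 1" using assms by simp
    have "(?k has_real_derivative r\<^sup>2 / (2 * (1 - r)\<^sup>2)) (at r)"
      using \<open>r < 1\<close> by (auto intro!: derivative_eq_intros)
        (simp add: divide_simps power2_eq_square, algebra)
    then show "\<exists>y. (?k has_real_derivative y) (at r) \<and> 0 \<le> y"
      by (intro exI[of _ "r\<^sup>2 / (2 * (1 - r)\<^sup>2)"]) simp
  qed
  then show ?thesis by simp
qed

text \<open>Concave and \<open>C\<^sup>1\<close>, with slope \<open>min 1 (k\<^sup>2 / a\<^sup>2)\<close>: a quantity \<open>a\<close> that drops by at least
  \<open>max 1 (a\<^sup>2 / k\<^sup>2)\<close> times a constant makes \<open>concave_cap k a\<close> drop by at least that constant, and
  the total drop is at most \<open>2k\<close>.\<close>

definition concave_cap :: "real \<Rightarrow> real \<Rightarrow> real" where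
  "concave_cap k a = (if a \<le> k then a else 2 * k - k\<^sup>2 / a)"

lemma concave_cap_bounds:
  assumes "0 < k" "0 \<le> a"
  shows "0 \<le> concave_cap k a" "concave_cap k a \<le> 2 * k"
  using assms by (auto simp: concave_cap_def field_simps power2_eq_square)

text \<open>A concave function lies below its tangent at \<open>a\<close>. The delicate case is
  \<open>b \<le> k < a\<close>, where the two branches meet between the points.\<close>

lemma concave_cap_tangent:
  assumes "0 < k" "0 \<le> b" "b \<le> a"
  shows "concave_cap k b + (if a \<le> k then 1 else k\<^sup>2 / a\<^sup>2) * (a - b) \<le> concave_cap k a"
proof (cases "a \<le> k")
  case True
  then show ?thesis using assms by (simp add: concave_cap_def)
next
  case a: False
  show ?thesis
  proof (cases "b \<le> k")
    case True
    \<comment> \<open>In terms of \<open>s\<close> the claim becomes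
      \<open>b * (1 - s^2) \<le> 2 * k * (1 - s)\<close>, which follows from
      \<open>b \<le> k\<close> and \<open>1 + s \<le> 2\<close>.\<close>
    define s where "s = k / a"
    have s: "0 < s" "s < 1" "k = s * a"
      using assms a by (auto simp: s_def)
    have "b * (1 - s\<^sup>2) \<le> k * (1 - s\<^sup>2)"
      using True s by (intro mult_right_mono) (auto simp: power_le_one)
    also have "\<dots> = k * (1 - s) * (1 + s)"
      by (simp add: power2_eq_square algebra_simps)
    also have "\<dots> \<le> k * (1 - s) * 2"
      using s assms by (intro mult_left_mono) auto
    finally have "b * (1 - s\<^sup>2) \<le> 2 * k * (1 - s)" by simp
    moreover have "k\<^sup>2 / a\<^sup>2 = s\<^sup>2" "k\<^sup>2 / a = s * k" "s\<^sup>2 * a = s * k"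
      using a assms by (simp_all add: s_def power2_eq_square)
    moreover have "concave_cap k b = b" "concave_cap k a = 2 * k - k\<^sup>2 / a"
      using a True by (simp_all add: concave_cap_def)
    ultimately show ?thesis
      using a by (simp add: algebra_simps)
  next
    case False
    have "k\<^sup>2 / a\<^sup>2 * (a - b) \<le> k\<^sup>2 / (a * b) * (a - b)"
      using assms False a by (intro mult_right_mono divide_left_mono) (auto simp: power2_eq_square)
    also have "\<dots> = k\<^sup>2 / b - k\<^sup>2 / a"
      using assms False a by (simp add: field_simps)
    finally show ?thesis
      using a False by (simp add: concave_cap_def)
  qed
qed

lemma concave_cap_mono:
  assumes "0 < k" "0 \<le> b" "b \<le> a"
  shows "concave_cap k b \<le> concave_cap k a"
proof -
  have "0 \<le> (if a \<le> k then 1 else k\<^sup>2 / a\<^sup>2) * (a - b)"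
    using assms by simp
  with concave_cap_tangent[OF assms] show ?thesis by linarith
qed

section \<open>Bounding the number of non-stopping iterations\<close>

text \<open>Each iteration adds at least 1 to the sum of five quantities: the accumulated drops of
  \<open>10.6 * \<Delta>\<close> and of \<open>A * concave_cap k \<Delta>\<close>, then
  \<open>L\<close>, and two indicators \<open>I\<close>. None of them ever decreases, and their
  total growth is bounded.\<close>

lemma iteration_count:
  fixes \<Delta> G \<delta> :: "nat \<Rightarrow> real"
  assumes eps: "0 < \<epsilon>" "\<epsilon> \<le> M"
    and nonneg: "\<And>t. t \<le> T \<Longrightarrow> 0 \<le> \<Delta> t"
    and nonstop: "\<And>t. t < T \<Longrightarrow> \<not> stop_test \<epsilon> (G t) (\<delta> t)"
    and large: "\<And>t. t < T \<Longrightarrow> M < G t \<Longrightarrow> \<Delta> (Suc t) \<le> \<Delta> t - 1 / 10.6"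
    and small: "\<And>t. t < T \<Longrightarrow> G t \<le> M \<Longrightarrow> \<Delta> (Suc t) \<le> \<Delta> t - (G t)\<^sup>2 / (12 * M\<^sup>2)"
    and gap: "\<And>t. t < T \<Longrightarrow> G t \<le> M \<Longrightarrow> \<Delta> t \<le> G t + \<delta> t"
    and accuracy: "\<And>s t. s < t \<Longrightarrow> t < T \<Longrightarrow> \<delta> t \<le> \<epsilon> / 2 + G s"
  shows "real T \<le> 10.6 * \<Delta> 0 + 84 * M\<^sup>2 / \<epsilon> + log 2 (M / \<epsilon>) + 2"
proof -
  \<comment> \<open>\<open>k\<close> is the value of \<open>\<Delta>\<close> at which
    \<open>2 / 7 * \<Delta>\<close> reaches \<open>\<epsilon>\<close>; \<open>A\<close> is the
    reciprocal of the drop guaranteed by a gap of size \<open>\<epsilon>\<close>.\<close>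
  define k where "k = 7 / 2 * \<epsilon>"
  define A where "A = 12 * M\<^sup>2 / \<epsilon>\<^sup>2"
  \<comment> \<open>Inserting \<open>M\<close> gives the minimum a value at \<open>t = 0\<close>.
    Replacing \<open>q t\<close> by at least \<open>\<epsilon>\<close> in \<open>L\<close> bounds
    \<open>L\<close> by \<open>log 2 (M / \<epsilon>)\<close>.\<close>
  define q where "q t = Min (insert M (G ` {..<t}))" for t
  define L where "L t = log 2 (M / max (q t) \<epsilon>)" for t
  define I where "I a t = (if \<exists>s<t. G s \<le> a then 1 else 0 :: real)" for a t
  have M: "0 < M" and k: "0 < k" and A: "0 < A"
    using eps by (auto simp: k_def A_def)
  have q_0: "q 0 = M" by (simp add: q_def)
  have q_Suc: "q (Suc t) = min (q t) (G t)" for t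
    by (simp add: q_def lessThan_Suc insert_commute[of _ "G t"] min.commute)
  have q_M: "q t \<le> M" for t by (simp add: q_def)
  have L_Suc: "L t \<le> L (Suc t)" for t
    unfolding L_def using eps M by (intro log_mono divide_left_mono) (auto simp: q_Suc)
  have I_Suc: "I a t \<le> I a (Suc t)" for a t
    by (auto simp: I_def less_Suc_eq)
  have "real t \<le> 10.6 * (\<Delta> 0 - \<Delta> t) + A * (concave_cap k (\<Delta> 0) - concave_cap k (\<Delta> t))
          + L t + I M t + I \<epsilon> t" if "t \<le> T" for t
    using that
  proof (induction t)
    case 0
    show ?case using eps M by (simp add: L_def q_0 I_def)
  next
    case (Suc t)
    then have t: "t < T" by simp
    have d: "0 \<le> \<Delta> t" "0 \<le> \<Delta> (Suc t)" using nonneg Suc.prems by auto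
    have drop: "\<Delta> (Suc t) \<le> \<Delta> t"
    proof (cases "M < G t")
      case True
      with large[OF t] show ?thesis by simp
    next
      case False
      have "0 \<le> (G t)\<^sup>2 / (12 * M\<^sup>2)" by simp
      with small[OF t] False show ?thesis by linarith
    qed
    then have drop': "0 \<le> 10.6 * (\<Delta> t - \<Delta> (Suc t))" by simp
    have cap: "A * concave_cap k (\<Delta> (Suc t)) \<le> A * concave_cap k (\<Delta> t)"
      using A k d drop by (intro mult_left_mono concave_cap_mono) auto
    have "1 \<le> 10.6 * (\<Delta> t - \<Delta> (Suc t))
            + (A * concave_cap k (\<Delta> t) - A * concave_cap k (\<Delta> (Suc t)))
            + (L (Suc t) - L t) + (I M (Suc t) - I M t) + (I \<epsilon> (Suc t) - I \<epsilon> t)"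
    proof -
      \<comment> \<open>The cases may overlap; in each, one quantity gains at least 1 and the others
        do not decrease.\<close>
      consider (big) "M < G t" | (first) "G t \<le> M" "\<forall>s<t. M < G s"
        | (accurate) "G t \<le> \<epsilon>" | (halving) "\<epsilon> < G t" "G t \<le> q t / 2"
        | (good) "G t \<le> M" "\<not> (\<forall>s<t. M < G s)" "\<epsilon> < G t" "q t / 2 < G t"
        by argo
      then show ?thesis
      proof cases
        case big
        have "1 \<le> 10.6 * (\<Delta> t - \<Delta> (Suc t))"
          using large[OF t big] by (simp add: field_simps)
        then show ?thesis
          using cap L_Suc[of t] I_Suc[of M t] I_Suc[of \<epsilon> t] by linarith
      next
        case first
        then have "I M (Suc t) - I M t = 1" by (auto simp: I_def)
        then show ?thesis using drop' cap L_Suc[of t] I_Suc[of \<epsilon> t] by linarith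
      next
        case accurate
        then have "3 * \<epsilon> / 2 < \<delta> t" using nonstop[OF t] by (simp add: stop_test_def)
        then have "\<forall>s<t. \<epsilon> < G s" using accuracy[of _ t] t by fastforce
        then have "I \<epsilon> (Suc t) - I \<epsilon> t = 1" using accurate by (auto simp: I_def)
        then show ?thesis using drop' cap L_Suc[of t] I_Suc[of M t] by linarith
      next
        case halving
        have "1 + L t = log 2 (2 * (M / q t))"
          using halving eps M by (subst log_mult) (auto simp: L_def max_def)
        also have "\<dots> \<le> log 2 (M / G t)"
          using halving eps M by (intro log_mono) (auto simp: field_simps)
        also have "\<dots> = L (Suc t)"
          using halving eps by (simp add: L_def q_Suc max_def min_def)
        finally show ?thesis using drop' cap I_Suc[of M t] I_Suc[of \<epsilon> t] by linarith
      next
        case good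
        then obtain s where s: "s < t" "G s \<le> M" by (meson linorder_not_less)
        \<comment> \<open>Since \<open>G s \<le> M\<close>, the running minimum is a genuine earlier
          gap \<open>G r\<close>, so the accuracy hypothesis applies at \<open>r\<close>.\<close>
        have "q t \<in> insert M (G ` {..<t})" unfolding q_def by (intro Min_in) auto
        moreover have "q t \<le> G s" unfolding q_def using s by (intro Min_le) auto
        ultimately obtain r where r: "r < t" "G r = q t"
          using s q_M[of t] by force
        have "\<Delta> t \<le> G t + (\<epsilon> / 2 + G r)"
          using gap[OF t] accuracy[OF r(1) t] good by linarith
        \<comment> \<open>Besides \<open>G t\<close> itself, \<open>\<epsilon> / 2\<close>
          contributes at most \<open>G t / 2\<close> and \<open>G r = q t\<close> at most
          \<open>2 * G t\<close>.\<close>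
        also have "\<dots> \<le> 7 / 2 * G t" using r good by linarith
        finally have "\<Delta> t \<le> 7 / 2 * G t" .
        \<comment> \<open>A lower bound on \<open>G t\<close> matched to the slope \<open>?s\<close>
          of the potential: \<open>?s * ?d^2\<close> is \<open>\<epsilon>^2\<close> on both
          branches.\<close>
        let ?d = "if \<Delta> t \<le> k then \<epsilon> else 2 / 7 * \<Delta> t"
        have "?d\<^sup>2 / (12 * M\<^sup>2) \<le> (G t)\<^sup>2 / (12 * M\<^sup>2)"
          using good \<open>\<Delta> t \<le> 7 / 2 * G t\<close> d eps
          by (intro divide_right_mono power_mono) auto
        then have step: "?d\<^sup>2 / (12 * M\<^sup>2) \<le> \<Delta> t - \<Delta> (Suc t)"
          using small[OF t] good(1) by linarith
        let ?s = "if \<Delta> t \<le> k then 1 else k\<^sup>2 / (\<Delta> t)\<^sup>2"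
        have "1 = A * ?s * (?d\<^sup>2 / (12 * M\<^sup>2))"
          using M eps k by (auto simp: A_def k_def power_mult_distrib power_divide)
        also have "\<dots> \<le> A * ?s * (\<Delta> t - \<Delta> (Suc t))"
          using A step by (intro mult_left_mono) auto
        also have "\<dots> = A * (?s * (\<Delta> t - \<Delta> (Suc t)))" by simp
        also have "\<dots> \<le> A * (concave_cap k (\<Delta> t) - concave_cap k (\<Delta> (Suc t)))"
          using A concave_cap_tangent[OF k d(2) drop] by (intro mult_left_mono) auto
        finally show ?thesis
          using drop' L_Suc[of t] I_Suc[of M t] I_Suc[of \<epsilon> t] unfolding right_diff_distrib[of A] by linarith
      qed
    qed
    with Suc.IH[OF Suc_leD[OF Suc.prems]] show ?case
      unfolding right_diff_distrib of_nat_Suc by linarith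
  qed
  from this[of T] have "real T \<le> 10.6 * (\<Delta> 0 - \<Delta> T)
      + A * (concave_cap k (\<Delta> 0) - concave_cap k (\<Delta> T)) + L T + I M T + I \<epsilon> T" by simp
  moreover have "L T \<le> log 2 (M / \<epsilon>)"
    unfolding L_def using eps M by (intro log_mono divide_left_mono) auto
  moreover have "I M T \<le> 1" "I \<epsilon> T \<le> 1" by (auto simp: I_def)
  moreover have "A * (concave_cap k (\<Delta> 0) - concave_cap k (\<Delta> T)) \<le> A * (2 * k)"
    using A concave_cap_bounds(2)[OF k nonneg[of 0]] concave_cap_bounds(1)[OF k nonneg[of T]]
    by (intro mult_left_mono) auto
  moreover have "A * (2 * k) = 84 * M\<^sup>2 / \<epsilon>"
    using eps by (simp add: A_def k_def power2_eq_square)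
  moreover have "10.6 * (\<Delta> 0 - \<Delta> T) \<le> 10.6 * \<Delta> 0" using nonneg[of T] by simp
  ultimately show ?thesis by linarith
qed

section \<open>Self-concordant logarithmically homogeneous barriers\<close>

text \<open>The adjoint of the derivative, evaluated at 1, represents it as an inner product;
  uniqueness of derivatives resolves the \<open>THE\<close>.\<close>

lemma gderiv_gradient:
  assumes "f differentiable (at w)"
  shows "GDERIV f w :> gradient f w"
proof -
  from assms obtain f' where f': "(f has_derivative f') (at w)"
    by (auto simp: differentiable_def)
  interpret linear f' by (rule has_derivative_linear[OF f'])
  have "f' = (\<lambda>u. u \<bullet> adjoint f' 1)"
    using adjoint_works[OF linear_axioms, of _ 1] by auto
  with f' have D: "GDERIV f w :> adjoint f' 1"
    unfolding gderiv_def by metis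
  then show ?thesis
    unfolding gradient_def
  proof (rule theI)
    fix E assume "GDERIV f w :> E"
    then have "(\<lambda>u. u \<bullet> E) = (\<lambda>u. u \<bullet> adjoint f' 1)"
      using D unfolding gderiv_def by (rule has_derivative_unique)
    then show "E = adjoint f' 1"
      by (metis inner_commute vector_eq_rdot)
  qed
qed

lemma has_real_derivative_along_line:
  fixes F :: "'a::real_inner \<Rightarrow> 'a"
  assumes "(F has_derivative F') (at (w + t *\<^sub>R v))"
  shows "((\<lambda>s. u \<bullet> F (w + s *\<^sub>R v)) has_real_derivative u \<bullet> F' v) (at t)"
proof -
  have "((\<lambda>s. F (w + s *\<^sub>R v)) has_derivative (\<lambda>h. F' (h *\<^sub>R v))) (at t)"
    by (rule has_derivative_compose[where f = "\<lambda>s. w + s *\<^sub>R v" and g = F, OF _ assms])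
      (auto intro!: derivative_eq_intros)
  then have "((\<lambda>s. u \<bullet> F (w + s *\<^sub>R v)) has_derivative (\<lambda>h. u \<bullet> F' (h *\<^sub>R v))) (at t)"
    by (rule has_derivative_inner_right)
  moreover have "(\<lambda>h. u \<bullet> F' (h *\<^sub>R v)) = (*) (u \<bullet> F' v)"
    using has_derivative_linear[OF assms] by (auto simp: linear_cmul)
  ultimately show ?thesis by (simp add: has_field_derivative_def)
qed

text \<open>The shift by \<open>\<eta>\<close> makes \<open>(p + \<eta>) powr (-1/2)\<close> differentiable; by the hypothesis it is
  1-Lipschitz, and \<open>\<eta> \<rightarrow> 0\<close> gives both bounds without assuming \<open>p > 0\<close>.\<close>

lemma self_concordant_sqrt_bounds:
  fixes p p' :: "real \<Rightarrow> real"
  assumes T: "0 \<le> T"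
    and deriv: "\<And>t. 0 \<le> t \<Longrightarrow> t \<le> T \<Longrightarrow> (p has_real_derivative p' t) (at t)"
    and nonneg: "\<And>t. 0 \<le> t \<Longrightarrow> t \<le> T \<Longrightarrow> 0 \<le> p t"
    and sc: "\<And>t. 0 \<le> t \<Longrightarrow> t \<le> T \<Longrightarrow> \<bar>p' t\<bar> \<le> 2 * p t powr (3 / 2)"
  shows "sqrt (p 0) \<le> sqrt (p T) * (1 + T * sqrt (p 0))"
    and "sqrt (p T) * (1 - T * sqrt (p 0)) \<le> sqrt (p 0)"
proof -
  have lip: "\<bar>1 / sqrt (p T + \<eta>) - 1 / sqrt (p 0 + \<eta>)\<bar> \<le> T" if "0 < \<eta>" for \<eta>
  proof -
    let ?q = "\<lambda>t. (p t + \<eta>) powr (- 1 / 2)"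
    have q: "?q t = 1 / sqrt (p t + \<eta>)" if "0 \<le> t" "t \<le> T" for t
      using nonneg[OF that] \<open>0 < \<eta>\<close> by (simp add: powr_minus_divide powr_half_sqrt)
    have q': "\<exists>y. (?q has_real_derivative y) (at t) \<and> \<bar>y\<bar> \<le> 1" if t: "0 \<le> t" "t \<le> T" for t
    proof -
      let ?y = "- 1 / 2 * (p t + \<eta>) powr (- 1 / 2 - 1) * p' t"
      have pos: "0 < p t + \<eta>" using nonneg[OF t] \<open>0 < \<eta>\<close> by simp
      have "(?q has_real_derivative ?y) (at t)"
        using pos by (auto intro!: derivative_eq_intros deriv[OF t] simp: powr_diff)
      moreover have "\<bar>?y\<bar> \<le> 1"
      proof -
        have "\<bar>?y\<bar> = 1 / 2 * (p t + \<eta>) powr (- (3 / 2)) * \<bar>p' t\<bar>"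
          by (simp add: abs_mult)
        also have "\<dots> \<le> 1 / 2 * (p t + \<eta>) powr (- (3 / 2)) * (2 * (p t + \<eta>) powr (3 / 2))"
          using sc[OF t] powr_mono2[of "3 / 2" "p t" "p t + \<eta>"] nonneg[OF t] \<open>0 < \<eta>\<close>
          by (intro mult_left_mono) auto
        also have "\<dots> = 1" using pos by (simp flip: powr_add)
        finally show ?thesis .
      qed
      ultimately show ?thesis by blast
    qed
    have "?q 0 + 0 \<le> ?q T + T"
    proof (rule DERIV_nonneg_imp_nondecreasing[OF T, of "\<lambda>t. ?q t + t"])
      fix t assume "0 \<le> t" "t \<le> T"
      with q' obtain y where "(?q has_real_derivative y) (at t)" "\<bar>y\<bar> \<le> 1" by blast
      then show "\<exists>y. ((\<lambda>t. ?q t + t) has_real_derivative y) (at t) \<and> 0 \<le> y"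
        by (intro exI[of _ "y + 1"]) (auto intro!: derivative_intros)
    qed
    moreover have "?q T - T \<le> ?q 0 - 0"
    proof (rule DERIV_nonpos_imp_nonincreasing[OF T, of "\<lambda>t. ?q t - t"])
      fix t assume "0 \<le> t" "t \<le> T"
      with q' obtain y where "(?q has_real_derivative y) (at t)" "\<bar>y\<bar> \<le> 1" by blast
      then show "\<exists>y. ((\<lambda>t. ?q t - t) has_real_derivative y) (at t) \<and> y \<le> 0"
        by (intro exI[of _ "y - 1"]) (auto intro!: derivative_intros)
    qed
    ultimately show ?thesis using q[of 0] q[of T] T by auto
  qed
  have lim: "((\<lambda>\<eta>. sqrt (p t + \<eta>)) \<longlongrightarrow> sqrt (p t)) (at_right 0)" for t
    by (auto intro!: tendsto_eq_intros)
  have bounds: "sqrt (p 0 + \<eta>) \<le> sqrt (p T + \<eta>) * (1 + T * sqrt (p 0 + \<eta>)) \<and>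
      sqrt (p T + \<eta>) * (1 - T * sqrt (p 0 + \<eta>)) \<le> sqrt (p 0 + \<eta>)" if "0 < \<eta>" for \<eta>
  proof -
    define a b where "a = sqrt (p 0 + \<eta>)" and "b = sqrt (p T + \<eta>)"
    have ab: "0 < a" "0 < b" using that nonneg[of 0] nonneg[of T] T by (auto simp: a_def b_def)
    have "\<bar>1 / b - 1 / a\<bar> \<le> T" using lip[OF that] by (simp add: a_def b_def)
    then have "a * b * (1 / b - 1 / a) \<le> a * b * T" "a * b * (1 / a - 1 / b) \<le> a * b * T"
      using ab by (intro mult_left_mono; simp)+
    then have "a - b \<le> a * b * T" "b - a \<le> a * b * T"
      using ab by (simp_all add: right_diff_distrib)
    then show ?thesis unfolding a_def[symmetric] b_def[symmetric] by (simp add: algebra_simps)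
  qed
  have ev: "eventually (\<lambda>\<eta>::real. 0 < \<eta>) (at_right 0)"
    by (simp add: eventually_at_right_less)
  show "sqrt (p 0) \<le> sqrt (p T) * (1 + T * sqrt (p 0))"
  proof (rule tendsto_le[of "at_right 0"])
    show "\<forall>\<^sub>F \<eta> in at_right 0. sqrt (p 0 + \<eta>) \<le> sqrt (p T + \<eta>) * (1 + T * sqrt (p 0 + \<eta>))"
      using ev by eventually_elim (use bounds in blast)
  qed (intro trivial_limit_at_right_real tendsto_intros lim)+
  show "sqrt (p T) * (1 - T * sqrt (p 0)) \<le> sqrt (p 0)"
  proof (rule tendsto_le[of "at_right 0"])
    show "\<forall>\<^sub>F \<eta> in at_right 0. sqrt (p T + \<eta>) * (1 - T * sqrt (p 0 + \<eta>)) \<le> sqrt (p 0 + \<eta>)"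
      using ev by eventually_elim (use bounds in blast)
  qed (intro trivial_limit_at_right_real tendsto_intros lim)+
qed

text \<open>\<open>H - F\<close> is nondecreasing. This plays the role of integration: curvature
  bounds become slope bounds, and slope bounds become bounds on \<open>f\<close>.\<close>

lemma diff_le_of_derivative_le:
  fixes F H :: "real \<Rightarrow> real"
  assumes "a \<le> b"
    and "\<And>t. a \<le> t \<Longrightarrow> t \<le> b \<Longrightarrow> (F has_real_derivative F' t) (at t)"
    and "\<And>t. a \<le> t \<Longrightarrow> t \<le> b \<Longrightarrow> (H has_real_derivative H' t) (at t)"
    and "\<And>t. a \<le> t \<Longrightarrow> t \<le> b \<Longrightarrow> F' t \<le> H' t"
  shows "F b - F a \<le> H b - H a"
proof -
  have "H a - F a \<le> H b - F b"
  proof (rule DERIV_nonneg_imp_nondecreasing[OF assms(1), of "\<lambda>t. H t - F t"])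
    fix t assume t: "a \<le> t" "t \<le> b"
    show "\<exists>y. ((\<lambda>t. H t - F t) has_real_derivative y) (at t) \<and> 0 \<le> y"
      using DERIV_diff[OF assms(3)[OF t] assms(2)[OF t]] assms(4)[OF t]
      by (intro exI[of _ "H' t - F' t"]) simp
  qed
  then show ?thesis by simp
qed

section \<open>The optimal step of the self-concordant upper bound\<close>

text \<open>For \<open>D > 0\<close> the left-hand side is convex in \<open>\<gamma>\<close> with
  minimizer \<open>G / (D * (D + G))\<close> and minimum \<open>- (G / D - ln (1 + G / D))\<close>.
  When the minimizer is truncated to 1, the decrease is still at least \<open>G / 2\<close>.\<close>

lemma step_size_decrease:
  fixes G D M :: real
  assumes "0 \<le> G" "0 \<le> D" "D \<le> G + M" "1 \<le> M"
  defines "\<gamma> \<equiv> step_size G D"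
  shows "0 \<le> \<gamma>" "\<gamma> \<le> 1" "\<gamma> * D < 1"
    and "- (\<gamma> * G) - \<gamma> * D - ln (1 - \<gamma> * D) \<le> - (if M < G then 1 / 10.6 else G\<^sup>2 / (12 * M\<^sup>2))"
proof -
  define dec where "dec = (if M < G then 1 / 10.6 else G\<^sup>2 / (12 * M\<^sup>2))"
  \<comment> \<open>Full steps and \<open>D = 0\<close> yield at least \<open>G / 2\<close>, so
    \<open>dec\<close> must stay below it; here \<open>1 \<le> M\<close> enters.\<close>
  have half: "dec \<le> G / 2"
  proof (cases "M < G")
    case False
    have "G * G \<le> G * (M * M)"
      using False assms mult_mono[of G M 1 M] by (intro mult_left_mono) auto
    then have "G\<^sup>2 / (12 * M\<^sup>2) \<le> G / 12"
      using assms by (simp add: pos_divide_le_eq power2_eq_square)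
    with False assms show ?thesis by (simp add: dec_def)
  qed (use assms in \<open>simp add: dec_def\<close>)
  consider (zero) "D = 0" | (short) "0 < D" "G < D * (D + G)" | (full) "0 < D" "D * (D + G) \<le> G"
    using assms by fastforce
  then have "0 \<le> \<gamma> \<and> \<gamma> \<le> 1 \<and> \<gamma> * D < 1 \<and> - (\<gamma> * G) - \<gamma> * D - ln (1 - \<gamma> * D) \<le> - dec"
  proof cases
    case zero
    then show ?thesis using half assms by (auto simp: \<gamma>_def step_size_def)
  next
    case full
    then have \<gamma>: "\<gamma> = 1" using assms by (simp add: \<gamma>_def step_size_def min_def add_pos_nonneg)
    have D: "D < 1"
    proof (rule ccontr)
      assume "\<not> D < 1"
      then have "1 * (D + G) \<le> D * (D + G)" using assms by (intro mult_right_mono) auto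
      with full show False by simp
    qed
    \<comment> \<open>The full-step condition, rearranged to bound the logarithmic loss by
      \<open>G / 2\<close>.\<close>
    have "D\<^sup>2 \<le> G * (1 - D)" using full by (simp add: power2_eq_square algebra_simps)
    then have "D\<^sup>2 / (2 * (1 - D)) \<le> G / 2" using D by (simp add: field_simps)
    with minus_ln_one_minus_le[OF assms(2) D] half D show ?thesis unfolding \<gamma> mult_1 by (intro conjI) linarith+
  next
    case short
    have s: "0 < D + G" using short assms by simp
    have "\<gamma> = G / (D * (D + G))" using short s by (simp add: \<gamma>_def step_size_def min_def)
    then have \<gamma>D: "\<gamma> * D = G / (D + G)" and "\<gamma> * G + \<gamma> * D = G / D"
      using short s by (simp_all add: divide_simps) (simp_all add: algebra_simps)
    moreover have "1 - G / (D + G) = inverse (1 + G / D)"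
      using short s by (simp add: field_simps)
    then have "ln (1 - G / (D + G)) = - ln (1 + G / D)"
      using short assms by (simp add: ln_inverse)
    ultimately have val: "- (\<gamma> * G) - \<gamma> * D - ln (1 - \<gamma> * D) = - (G / D - ln (1 + G / D))"
      by simp
    have "dec \<le> G / D - ln (1 + G / D)"
    proof (cases "M < G")
      case True
      \<comment> \<open>Here \<open>D \<le> G + M < 2 * G\<close>, hence
        \<open>G / D \<ge> 1 / 2\<close>.\<close>
      have "1 / 10.6 \<le> 1 / 2 - ln (1 + 1 / 2 :: real)" using ln_three_halves_le by simp
      also have "\<dots> \<le> G / D - ln (1 + G / D)"
        using True assms short by (intro minus_ln_one_plus_mono) (auto simp: field_simps)
      finally show ?thesis using True by (simp add: dec_def)
    next
      case False
      \<comment> \<open>The quantity \<open>G / (2 * M)\<close> is at most 1/2, and at most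
        \<open>G / D\<close> because \<open>D \<le> 2 * M\<close>.\<close>
      have "G\<^sup>2 / (12 * M\<^sup>2) = (G / (2 * M))\<^sup>2 / 3" by (simp add: power2_eq_square)
      also have "\<dots> \<le> G / (2 * M) - ln (1 + G / (2 * M))"
        using False assms by (intro minus_ln_one_plus_ge) (auto simp: field_simps)
      also have "\<dots> \<le> G / D - ln (1 + G / D)"
        using False assms short by (intro minus_ln_one_plus_mono divide_left_mono) auto
      finally show ?thesis using False by (simp add: dec_def)
    qed
    moreover have "0 \<le> \<gamma>" "\<gamma> \<le> 1" by (use short s assms in \<open>auto simp: \<gamma>_def step_size_def\<close>)
    moreover have "\<gamma> * D < 1" using \<gamma>D short s by simp
    ultimately show ?thesis using val by linarith
  qed
  then show "0 \<le> \<gamma>" "\<gamma> \<le> 1" "\<gamma> * D < 1"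
    and "- (\<gamma> * G) - \<gamma> * D - ln (1 - \<gamma> * D) \<le> - dec" unfolding dec_def by blast+
qed

section \<open>The cone and its interior\<close>

locale log_homogeneous_barrier =
  fixes C :: "'a::euclidean_space set" and f :: "'a \<Rightarrow> real" and \<theta> :: real
  assumes cone: "proper_cone C"
    and barrier: "sc_log_homogeneous_barrier C \<theta> f"
begin

lemma convex_cone: "convex C" "closed C" "interior C \<noteq> {}"
  using cone by (auto simp: proper_cone_def)

lemma scaleR_mem: "x \<in> C \<Longrightarrow> 0 \<le> c \<Longrightarrow> c *\<^sub>R x \<in> C"
  using cone by (auto simp: proper_cone_def cone_def)

lemma zero_notin_interior: "0 \<notin> interior C"
proof
  assume "0 \<in> interior C"
  then obtain e where e: "e > 0" "ball 0 e \<subseteq> C"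
    by (auto simp: mem_interior)
  obtain b :: 'a where b: "b \<in> Basis" using nonempty_Basis by blast
  have "(e / 2) *\<^sub>R b \<in> C" "- ((e / 2) *\<^sub>R b) \<in> C"
    using e b by (auto intro!: subsetD[OF e(2)])
  then have "(e / 2) *\<^sub>R b = 0" using cone unfolding proper_cone_def by blast
  then show False using e b nonzero_Basis by auto
qed

lemma scaleR_interior:
  assumes "w \<in> interior C" "0 < c"
  shows "c *\<^sub>R w \<in> interior C"
proof -
  have "(*\<^sub>R) c ` interior C \<subseteq> interior C"
    using assms interior_subset
    by (intro interior_maximal open_scaling) (auto intro!: scaleR_mem)
  then show ?thesis using assms by auto
qed

text \<open>The sum is twice the midpoint of \<open>w\<close> and \<open>v\<close>, which is
  interior because \<open>w\<close> is.\<close>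

lemma add_interior:
  assumes "w \<in> interior C" "v \<in> C"
  shows "w + v \<in> interior C"
proof -
  have "v - (1 / 2) *\<^sub>R (v - w) \<in> interior C"
    using convex_cone assms closure_subset by (intro mem_interior_closure_convex_shrink) auto
  from scaleR_interior[OF this, of 2] show ?thesis
    by (simp add: algebra_simps scaleR_2)
qed

lemma segment_interior:
  assumes "w \<in> interior C" "w + v \<in> C" "0 \<le> t" "t < 1"
  shows "w + t *\<^sub>R v \<in> interior C"
proof -
  have "(w + v) - (1 - t) *\<^sub>R ((w + v) - w) \<in> interior C"
    using convex_cone assms closure_subset by (intro mem_interior_closure_convex_shrink) auto
  then show ?thesis by (simp add: algebra_simps)
qed

section \<open>Gradient, Hessian and third derivative from directional derivatives\<close>

lemma differentiable_barrier:
  assumes "w \<in> interior C"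
  shows "f differentiable (at w)"
    and "(\<lambda>y. frechet_derivative f (at y) u) differentiable (at w)"
    and "(\<lambda>y. frechet_derivative (\<lambda>y. frechet_derivative f (at y) u) (at y) v) differentiable (at w)"
proof -
  have "C_k_on (Suc (Suc (Suc 0))) (interior C) f"
    using barrier unfolding sc_log_homogeneous_barrier_def numeral_3_eq_3 by blast
  then show "f differentiable (at w)"
    and "(\<lambda>y. frechet_derivative f (at y) u) differentiable (at w)"
    and "(\<lambda>y. frechet_derivative (\<lambda>y. frechet_derivative f (at y) u) (at y) v) differentiable (at w)"
    unfolding C_k_on.simps using assms by blast+
qed

lemma has_derivative_gradient:
  assumes "w \<in> interior C"
  shows "(f has_derivative (\<lambda>u. u \<bullet> gradient f w)) (at w)"
  using gderiv_gradient[OF differentiable_barrier(1)[OF assms]] by (simp add: gderiv_def)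

lemma frechet_derivative_eq_inner_gradient:
  assumes "w \<in> interior C"
  shows "frechet_derivative f (at w) u = gradient f w \<bullet> u"
  by (subst frechet_derivative_at[OF has_derivative_gradient[OF assms], symmetric])
    (rule inner_commute)

lemma differentiable_transform_interior:
  assumes "F differentiable (at w)" "w \<in> interior C" "\<And>y. y \<in> interior C \<Longrightarrow> F y = F' y"
  shows "F' differentiable (at w)"
proof -
  from assms(1) obtain D where "(F has_derivative D) (at w)"
    by (auto simp: differentiable_def)
  then have "(F' has_derivative D) (at w)"
    by (rule has_derivative_transform_within_open[OF _ open_interior assms(2,3)])
  then show ?thesis by (rule differentiableI)
qed

text \<open>On the interior, the components of the gradient are the directional derivatives
  controlled by \<open>C_k_on\<close>; differentiability is then assembled componentwise.\<close>

lemma has_derivative_hessian: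
  assumes "w \<in> interior C"
  shows "(gradient f has_derivative hessian f w) (at w)"
proof -
  have "gradient f differentiable (at w)"
  proof (rule differentiable_componentwise_within[THEN iffD2], rule)
    fix u :: 'a
    from differentiable_barrier(2)[OF assms]
    show "(\<lambda>y. gradient f y \<bullet> u) differentiable (at w)"
      by (rule differentiable_transform_interior[OF _ assms])
        (simp add: frechet_derivative_eq_inner_gradient)
  qed
  then show ?thesis
    unfolding hessian_def by (simp add: frechet_derivative_works)
qed

lemma linear_hessian: "w \<in> interior C \<Longrightarrow> linear (hessian f w)"
  by (rule has_derivative_linear[OF has_derivative_hessian])

lemma frechet_derivative_frechet_derivative_eq:
  assumes "w \<in> interior C"
  shows "frechet_derivative (\<lambda>y. frechet_derivative f (at y) u) (at w) v = hessian f w v \<bullet> u"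
proof -
  have "((\<lambda>y. gradient f y \<bullet> u) has_derivative (\<lambda>v. hessian f w v \<bullet> u)) (at w)"
    by (rule has_derivative_inner_left[OF has_derivative_hessian[OF assms]])
  then have "((\<lambda>y. frechet_derivative f (at y) u) has_derivative (\<lambda>v. hessian f w v \<bullet> u)) (at w)"
    by (rule has_derivative_transform_within_open[OF _ open_interior assms])
      (simp add: frechet_derivative_eq_inner_gradient)
  from frechet_derivative_at[OF this, symmetric] show ?thesis by simp
qed

lemma has_derivative_third_derivative:
  assumes "w \<in> interior C"
  shows "((\<lambda>y. hessian f y v) has_derivative third_derivative f w v) (at w)"
proof -
  have "(\<lambda>y. hessian f y v) differentiable (at w)"
  proof (rule differentiable_componentwise_within[THEN iffD2], rule)
    fix u :: 'a
    from differentiable_barrier(3)[OF assms]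
    show "(\<lambda>y. hessian f y v \<bullet> u) differentiable (at w)"
      by (rule differentiable_transform_interior[OF _ assms])
        (simp add: frechet_derivative_frechet_derivative_eq)
  qed
  then show ?thesis
    by (simp add: frechet_derivative_works third_derivative_def[abs_def])
qed

lemma line_derivs:
  assumes "w + t *\<^sub>R v \<in> interior C"
  shows "((\<lambda>s. f (w + s *\<^sub>R v)) has_real_derivative v \<bullet> gradient f (w + t *\<^sub>R v)) (at t)"
    and "((\<lambda>s. v \<bullet> gradient f (w + s *\<^sub>R v)) has_real_derivative
           v \<bullet> hessian f (w + t *\<^sub>R v) v) (at t)"
    and "((\<lambda>s. v \<bullet> hessian f (w + s *\<^sub>R v) v) has_real_derivative
           v \<bullet> third_derivative f (w + t *\<^sub>R v) v v) (at t)"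
proof -
  have "((\<lambda>s. f (w + s *\<^sub>R v)) has_derivative (\<lambda>h. (h *\<^sub>R v) \<bullet> gradient f (w + t *\<^sub>R v))) (at t)"
    by (rule has_derivative_compose[where f = "\<lambda>s. w + s *\<^sub>R v" and g = f,
          OF _ has_derivative_gradient[OF assms]])
      (auto intro!: derivative_eq_intros)
  then show "((\<lambda>s. f (w + s *\<^sub>R v)) has_real_derivative v \<bullet> gradient f (w + t *\<^sub>R v)) (at t)"
    by (simp add: has_field_derivative_def mult_commute_abs)
qed (intro has_real_derivative_along_line has_derivative_hessian has_derivative_third_derivative assms)+

section \<open>First- and second-order consequences of convexity\<close>

text \<open>Restricted to the line through \<open>w\<close> and \<open>z\<close>, \<open>f\<close>
  is convex in one variable and so lies above its tangent.\<close>

lemma gradient_inequality: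
  assumes "w \<in> interior C" "z \<in> interior C"
  shows "f w + (z - w) \<bullet> gradient f w \<le> f z"
proof -
  let ?A = "{t. w + t *\<^sub>R (z - w) \<in> interior C}"
  have conv: "convex_on (interior C) f"
  proof (rule convex_onI)
    fix t :: real and x y assume *: "0 < t" "t < 1" "x \<in> interior C" "y \<in> interior C"
    show "f ((1 - t) *\<^sub>R x + t *\<^sub>R y) \<le> (1 - t) * f x + t * f y"
    proof (cases "x = y")
      case True
      then show ?thesis by (simp add: algebra_simps)
    next
      case False
      with * barrier show ?thesis
        unfolding sc_log_homogeneous_barrier_def strictly_convex_on_def by (meson less_imp_le)
    qed
  qed (simp add: convex_interior convex_cone)
  have line: "w + ((1 - u) * s + u * t) *\<^sub>R (z - w)
      = (1 - u) *\<^sub>R (w + s *\<^sub>R (z - w)) + u *\<^sub>R (w + t *\<^sub>R (z - w))" for s t u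
    by (simp add: algebra_simps)
  have cA: "convex ?A"
    unfolding convex_alt
    using convex_interior[OF convex_cone(1), unfolded convex_alt] by (auto simp: line)
  have "convex_on ?A (\<lambda>t. f (w + t *\<^sub>R (z - w)))"
    using cA by (intro convex_onI) (simp_all add: line convex_onD[OF conv])
  moreover have "open ((\<lambda>t. w + t *\<^sub>R (z - w)) -` interior C)"
    by (intro open_vimage continuous_intros open_interior)
  then have "open ?A" by (simp add: vimage_def)
  then have "0 \<in> interior ?A"
    using assms(1) by (simp add: interior_open)
  moreover have "((\<lambda>t. f (w + t *\<^sub>R (z - w))) has_real_derivative (z - w) \<bullet> gradient f w) (at 0 within ?A)"
    using line_derivs(1)[of w 0 "z - w"] assms(1) by (simp add: has_field_derivative_at_within)
  ultimately have "(z - w) \<bullet> gradient f w * (1 - 0) \<le> f (w + 1 *\<^sub>R (z - w)) - f (w + 0 *\<^sub>R (z - w))"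
    using assms(2) convex_connected[OF cA]
    by (intro convex_on_imp_above_tangent[of ?A "\<lambda>t. f (w + t *\<^sub>R (z - w))" 0 1]) simp_all
  then show ?thesis by simp
qed

lemma gradient_monotone:
  assumes "w \<in> interior C" "z \<in> interior C"
  shows "(z - w) \<bullet> gradient f w \<le> (z - w) \<bullet> gradient f z"
  using gradient_inequality[OF assms] gradient_inequality[OF assms(2,1)]
  by (simp add: inner_diff_left)

text \<open>A negative value would make the slope along \<open>v\<close> fall strictly just after
  \<open>w\<close>, against monotonicity of the gradient.\<close>

lemma hessian_nonneg:
  assumes "w \<in> interior C"
  shows "0 \<le> v \<bullet> hessian f w v"
proof (rule ccontr)
  let ?d = "\<lambda>t. v \<bullet> gradient f (w + t *\<^sub>R v)"
  assume "\<not> 0 \<le> v \<bullet> hessian f w v"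
  then have "v \<bullet> hessian f w v < 0" by simp
  moreover have "(?d has_real_derivative v \<bullet> hessian f w v) (at 0)"
    using line_derivs(2)[of w 0 v] assms by simp
  ultimately obtain e where e: "0 < e" "\<forall>h>0. 0 + h \<in> UNIV \<longrightarrow> h < e \<longrightarrow> ?d (0 + h) < ?d 0"
    using has_real_derivative_neg_dec_right[of ?d _ 0 UNIV] by blast
  have "open ((\<lambda>t. w + t *\<^sub>R v) -` interior C)"
    by (intro open_vimage continuous_intros open_interior)
  moreover have "0 \<in> (\<lambda>t. w + t *\<^sub>R v) -` interior C"
    using assms by simp
  ultimately obtain e' where e': "0 < e'" "ball 0 e' \<subseteq> (\<lambda>t. w + t *\<^sub>R v) -` interior C"
    by (rule openE)
  define h where "h = min e e' / 2"
  have h: "0 < h" "h < e" "h < e'" using e(1) e'(1) by (auto simp: h_def)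
  then have "h \<in> ball 0 e'" by simp
  with e'(2) have "w + h *\<^sub>R v \<in> interior C" by blast
  from gradient_monotone[OF assms this] h(1) have "?d 0 \<le> ?d h" by simp
  moreover have "?d h < ?d 0" using e(2) h by simp
  ultimately show False by simp
qed

lemma self_concordant:
  "w \<in> interior C \<Longrightarrow> \<bar>u \<bullet> third_derivative f w u u\<bar> \<le> 2 * (u \<bullet> hessian f w u) powr (3 / 2)"
  using barrier by (simp add: sc_log_homogeneous_barrier_def)

lemma homogeneous: "w \<in> interior C \<Longrightarrow> 0 < c \<Longrightarrow> f (c *\<^sub>R w) = f w - \<theta> * ln c"
  using barrier by (simp add: sc_log_homogeneous_barrier_def)

section \<open>Identities from logarithmic homogeneity\<close>

lemma gradient_scaleR:
  assumes "w \<in> interior C" "0 < c"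
  shows "gradient f w = c *\<^sub>R gradient f (c *\<^sub>R w)"
proof -
  have "((\<lambda>y. f (c *\<^sub>R y)) has_derivative (\<lambda>u. (c *\<^sub>R u) \<bullet> gradient f (c *\<^sub>R w))) (at w)"
    by (rule has_derivative_compose[OF _ has_derivative_gradient])
      (auto intro!: derivative_eq_intros scaleR_interior assms)
  then have "((\<lambda>y. f y - \<theta> * ln c) has_derivative (\<lambda>u. (c *\<^sub>R u) \<bullet> gradient f (c *\<^sub>R w))) (at w)"
    by (rule has_derivative_transform_within_open[OF _ open_interior assms(1)])
      (simp add: homogeneous assms)
  moreover have "((\<lambda>y. f y - \<theta> * ln c) has_derivative (\<lambda>u. u \<bullet> gradient f w)) (at w)"
    by (auto intro!: derivative_eq_intros has_derivative_gradient assms)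
  ultimately have "(\<lambda>u. u \<bullet> (c *\<^sub>R gradient f (c *\<^sub>R w))) = (\<lambda>u. u \<bullet> gradient f w)"
    by (auto dest: has_derivative_unique)
  then show ?thesis by (metis vector_eq_rdot inner_commute)
qed

lemma inner_gradient_self:
  assumes "w \<in> interior C"
  shows "w \<bullet> gradient f w = - \<theta>"
proof -
  have "((\<lambda>s. f (w + s *\<^sub>R w)) has_real_derivative w \<bullet> gradient f w) (at 0)"
    using line_derivs(1)[of w 0 w] assms by simp
  moreover have "((\<lambda>s. f w - \<theta> * ln (1 + s)) has_real_derivative - \<theta>) (at 0)"
    by (auto intro!: derivative_eq_intros)
  then have "((\<lambda>s. f (w + s *\<^sub>R w)) has_real_derivative - \<theta>) (at 0)"
    unfolding has_field_derivative_def
    by (rule has_derivative_transform_within_open[of _ _ _ _ "{- 1 <..}"])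
      (use homogeneous[OF assms, of "1 + _"] in \<open>auto simp: scaleR_left_distrib\<close>)
  ultimately show ?thesis by (rule DERIV_unique)
qed

text \<open>The gradient is homogeneous of degree -1; this is its derivative along the ray through
  \<open>w\<close>.\<close>

lemma hessian_self:
  assumes "w \<in> interior C"
  shows "hessian f w w = - gradient f w"
proof (rule vector_eq_rdot[THEN iffD1, rule_format])
  fix u
  have "((\<lambda>s. u \<bullet> gradient f (w + s *\<^sub>R w)) has_real_derivative u \<bullet> hessian f w w) (at 0)"
    using has_real_derivative_along_line[OF has_derivative_hessian, of w 0 w u] assms by simp
  moreover have "((\<lambda>s. (u \<bullet> gradient f w) / (1 + s)) has_real_derivative - (u \<bullet> gradient f w)) (at 0)"
    by (auto intro!: derivative_eq_intros)
  then have "((\<lambda>s. u \<bullet> gradient f (w + s *\<^sub>R w)) has_real_derivative - (u \<bullet> gradient f w)) (at 0)"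
    unfolding has_field_derivative_def
  proof (rule has_derivative_transform_within_open[of _ _ _ _ "{- 1 <..}"])
    fix s :: real assume "s \<in> {- 1 <..}"
    then have "0 < 1 + s" by simp
    have line: "w + s *\<^sub>R w = (1 + s) *\<^sub>R w" by (simp add: scaleR_left_distrib)
    then show "u \<bullet> gradient f w / (1 + s) = u \<bullet> gradient f (w + s *\<^sub>R w)"
      using gradient_scaleR[OF assms \<open>0 < 1 + s\<close>] \<open>0 < 1 + s\<close>
      by (simp add: line)
  qed auto
  ultimately show "hessian f w w \<bullet> u = - gradient f w \<bullet> u"
    by (simp add: DERIV_unique inner_commute)
qed

text \<open>Differentiates the constant function \<open>y \<bullet> gradient f y\<close>. It
  complements \<open>hessian_self\<close>, with \<open>w\<close> in the other slot of the Hessian;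
  expanding the norm of \<open>v - w\<close> uses both.\<close>

lemma inner_hessian_self:
  assumes "w \<in> interior C"
  shows "w \<bullet> hessian f w v = - (v \<bullet> gradient f w)"
proof -
  have "((\<lambda>y. y \<bullet> gradient f y) has_derivative (\<lambda>v. w \<bullet> hessian f w v + v \<bullet> gradient f w)) (at w)"
    using has_derivative_inner[OF has_derivative_ident has_derivative_hessian[OF assms]] by simp
  moreover have "((\<lambda>y. y \<bullet> gradient f y) has_derivative (\<lambda>v. 0)) (at w)"
    by (rule has_derivative_transform_within_open[OF has_derivative_const open_interior assms, of "- \<theta>"])
      (simp add: inner_gradient_self)
  ultimately have "(\<lambda>v. w \<bullet> hessian f w v + v \<bullet> gradient f w) = (\<lambda>v. 0)"
    by (rule has_derivative_unique)
  then show ?thesis by (metis add_eq_0_iff2)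
qed

lemma filterlim_barrier:
  assumes "\<And>i. w i \<in> interior C" "z \<in> frontier C" "w \<longlonglongrightarrow> z"
  shows "filterlim (\<lambda>i. f (w i)) at_top sequentially"
proof -
  have "\<forall>w z. (\<forall>i. w i \<in> interior C) \<and> z \<in> frontier C \<and> w \<longlonglongrightarrow> z \<longrightarrow>
      filterlim (\<lambda>i. f (w i)) at_top sequentially"
    using barrier unfolding sc_log_homogeneous_barrier_def by blast
  from this[rule_format, of w z] show ?thesis using assms by simp
qed

text \<open>Strict convexity at the midpoint of \<open>w\<close> and its double, read through
  homogeneity, gives \<open>0 < \<theta> * (2 * ln (3 / 2) - ln 2)\<close>, and the bracket is
  positive because \<open>(3 / 2)^2 > 2\<close>.\<close>

lemma theta_pos: "0 < \<theta>"
proof -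
  obtain w where w: "w \<in> interior C" using convex_cone by blast
  then have "w \<noteq> 2 *\<^sub>R w" using zero_notin_interior by (metis add_cancel_right_right scaleR_2)
  moreover have "2 *\<^sub>R w \<in> interior C" using scaleR_interior[OF w, of 2] by simp
  moreover have sc: "\<forall>x\<in>interior C. \<forall>y\<in>interior C. \<forall>t. x \<noteq> y \<and> 0 < t \<and> t < 1 \<longrightarrow>
      f ((1 - t) *\<^sub>R x + t *\<^sub>R y) < (1 - t) * f x + t * f y"
    using barrier unfolding sc_log_homogeneous_barrier_def strictly_convex_on_def by blast
  ultimately have "f ((1 - 1 / 2) *\<^sub>R w + (1 / 2) *\<^sub>R (2 *\<^sub>R w))
      < (1 - 1 / 2) * f w + 1 / 2 * f (2 *\<^sub>R w)"
    using w by (intro sc[rule_format]) simp_all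
  moreover have "(1 - 1 / 2) *\<^sub>R w + (1 / 2) *\<^sub>R (2 *\<^sub>R w) = (3 / 2) *\<^sub>R w"
    unfolding scaleR_scaleR scaleR_left_distrib[symmetric] by simp
  ultimately have "f ((3 / 2) *\<^sub>R w) < 1 / 2 * f w + 1 / 2 * f (2 *\<^sub>R w)"
    by simp
  then have "0 < \<theta> * (2 * ln (3 / 2) - ln 2)"
    using w by (simp add: homogeneous algebra_simps)
  moreover have "ln 2 < 2 * ln (3 / 2 :: real)"
  proof -
    have "ln 2 < ln ((3 / 2)\<^sup>2 :: real)" by (subst ln_less_cancel_iff) (auto simp: power2_eq_square)
    then show ?thesis by (simp add: ln_realpow)
  qed
  ultimately show ?thesis by (simp add: zero_less_mult_iff)
qed

text \<open>Along the ray through \<open>w\<close> the second derivative is \<open>\<theta> / (1 + s)\<^sup>2\<close>, so self-concordance at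
  \<open>s = 0\<close> reads \<open>2\<theta> \<le> 2\<theta> powr (3/2)\<close>.\<close>

lemma theta_ge_1: "1 \<le> \<theta>"
proof -
  obtain w where w: "w \<in> interior C" using convex_cone by blast
  have "((\<lambda>s. \<theta> / (1 + s)\<^sup>2) has_real_derivative - (2 * \<theta>)) (at 0)"
    by (auto intro!: derivative_eq_intros)
  then have "((\<lambda>s. w \<bullet> hessian f (w + s *\<^sub>R w) w) has_real_derivative - (2 * \<theta>)) (at 0)"
    unfolding has_field_derivative_def
  proof (rule has_derivative_transform_within_open[of _ _ _ _ "{- 1 <..}"])
    fix s :: real assume "s \<in> {- 1 <..}"
    then have s: "0 < 1 + s" by simp
    define z where "z = (1 + s) *\<^sub>R w"
    have z: "z \<in> interior C" using scaleR_interior[OF w s] by (simp add: z_def)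
    have "(1 + s) * ((1 + s) * (w \<bullet> hessian f z w)) = (1 + s) * (z \<bullet> hessian f z w)"
      by (simp add: z_def)
    also have "\<dots> = - (z \<bullet> gradient f z)"
      by (subst inner_hessian_self[OF z]) (simp add: z_def)
    also have "\<dots> = \<theta>" by (simp add: inner_gradient_self[OF z])
    finally have "w \<bullet> hessian f z w = \<theta> / (1 + s)\<^sup>2"
      using s by (simp add: eq_divide_eq power2_eq_square mult_ac)
    then show "\<theta> / (1 + s)\<^sup>2 = w \<bullet> hessian f (w + s *\<^sub>R w) w"
      by (simp add: z_def scaleR_left_distrib)
  qed auto
  moreover have "((\<lambda>s. w \<bullet> hessian f (w + s *\<^sub>R w) w) has_real_derivative
      w \<bullet> third_derivative f w w w) (at 0)"
    using line_derivs(3)[of w 0 w] w by simp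
  ultimately have "w \<bullet> third_derivative f w w w = - (2 * \<theta>)"
    by (metis DERIV_unique)
  moreover have "w \<bullet> hessian f w w = \<theta>"
    using inner_hessian_self[OF w] inner_gradient_self[OF w] by simp
  ultimately have "\<theta> \<le> \<theta> powr (3 / 2)"
    using self_concordant[OF w, of w] theta_pos by simp
  then have "\<theta> powr 1 \<le> \<theta> powr (3 / 2)" using theta_pos by simp
  then show ?thesis
    using powr_less_mono'[of \<theta> 1 "3 / 2"] theta_pos by (cases "\<theta> < 1") auto
qed

text \<open>Homogeneity keeps \<open>f\<close> from growing along multiples \<open>c \<ge> 1\<close>
  of an interior \<open>v\<close>, while a positive slope would make the tangent at \<open>w\<close>
  grow linearly in \<open>c\<close>. The remaining \<open>v\<close> follow by closure.\<close>

lemma inner_gradient_nonpos: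
  assumes w: "w \<in> interior C" and "v \<in> C"
  shows "v \<bullet> gradient f w \<le> 0"
proof -
  have "v \<bullet> gradient f w \<le> 0" if v: "v \<in> interior C" for v
  proof (rule ccontr)
    define a where "a = v \<bullet> gradient f w"
    assume "\<not> v \<bullet> gradient f w \<le> 0"
    then have a: "0 < a" by (simp add: a_def)
    \<comment> \<open>Large enough that the tangent at \<open>w\<close> exceeds \<open>f v\<close>
      by at least 1.\<close>
    define c where "c = max 1 ((f v - f w - \<theta> + 1) / a)"
    have c: "1 \<le> c" "f v - f w - \<theta> + 1 \<le> c * a"
      using a by (auto simp: c_def pos_divide_le_eq[symmetric])
    have "f w + (c *\<^sub>R v - w) \<bullet> gradient f w \<le> f (c *\<^sub>R v)"
      using gradient_inequality[OF w scaleR_interior[OF v]] c by simp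
    then have "f w + c * a + \<theta> \<le> f v - \<theta> * ln c"
      using c v by (simp add: homogeneous inner_diff_left inner_gradient_self[OF w] a_def)
    moreover have "0 \<le> \<theta> * ln c" using c theta_pos by simp
    ultimately show False using c by linarith
  qed
  then have "closure (interior C) \<subseteq> {v. gradient f w \<bullet> v \<le> 0}"
    by (intro closure_minimal closed_halfspace_le) (auto simp: inner_commute)
  moreover have "v \<in> closure (interior C)"
    using convex_closure_interior convex_cone closure_subset assms(2) by blast
  ultimately show ?thesis by (auto simp: inner_commute)
qed

section \<open>Local norms and self-concordant bounds\<close>

lemma local_norm_nonneg [simp]: "w \<in> interior C \<Longrightarrow> 0 \<le> local_norm f w v"
  by (simp add: local_norm_def hessian_nonneg)

lemma local_norm_power2: "w \<in> interior C \<Longrightarrow> (local_norm f w v)\<^sup>2 = v \<bullet> hessian f w v"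
  by (simp add: local_norm_def hessian_nonneg)

lemma local_norm_scaleR:
  assumes "w \<in> interior C" "0 \<le> c"
  shows "local_norm f w (c *\<^sub>R v) = c * local_norm f w v"
proof (rule power2_eq_imp_eq)
  show "(local_norm f w (c *\<^sub>R v))\<^sup>2 = (c * local_norm f w v)\<^sup>2"
    using assms by (simp add: local_norm_power2 power_mult_distrib linear_cmul[OF linear_hessian])
      (simp add: power2_eq_square)
qed (use assms in auto)

lemma local_norm_along_line:
  assumes "0 \<le> T" "\<And>t. 0 \<le> t \<Longrightarrow> t \<le> T \<Longrightarrow> w + t *\<^sub>R v \<in> interior C"
  shows "local_norm f w v \<le> local_norm f (w + T *\<^sub>R v) v * (1 + T * local_norm f w v)"
    and "local_norm f (w + T *\<^sub>R v) v * (1 - T * local_norm f w v) \<le> local_norm f w v"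
  using self_concordant_sqrt_bounds[OF assms(1) line_derivs(3)[OF assms(2)]
      hessian_nonneg[OF assms(2)] self_concordant[OF assms(2)]]
  by (simp_all add: local_norm_def)

text \<open>Along the ray the curvature is at least \<open>(r / (1 + r * t))^2\<close>, so the slope
  rises by at least \<open>r^2 * T / (1 + r * T)\<close>, which tends to \<open>r\<close>. The slope
  starts at \<open>- a\<close> and never becomes positive, which excludes
  \<open>a < r\<close>.\<close>

lemma local_norm_le_inner_gradient:
  assumes w: "w \<in> interior C" and v: "v \<in> C"
  shows "local_norm f w v \<le> - (v \<bullet> gradient f w)"
proof (rule ccontr)
  define r where "r = local_norm f w v"
  define a where "a = - (v \<bullet> gradient f w)"
  assume "\<not> ?thesis"
  then have ra: "a < r" by (simp add: r_def a_def)
  have a: "0 \<le> a" using inner_gradient_nonpos[OF w v] by (simp add: a_def)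
  have int: "w + t *\<^sub>R v \<in> interior C" if "0 \<le> t" for t
    using add_interior[OF w scaleR_mem[OF v that]] .
  have bound: "r\<^sup>2 * T / (1 + r * T) \<le> a" if T: "0 \<le> T" for T
  proof -
    have "r\<^sup>2 * T / (1 + r * T) - r\<^sup>2 * 0 / (1 + r * 0)
      \<le> v \<bullet> gradient f (w + T *\<^sub>R v) - v \<bullet> gradient f (w + 0 *\<^sub>R v)"
    proof (rule diff_le_of_derivative_le[OF T])
      fix t assume t: "0 \<le> t" "t \<le> T"
      then have pos: "0 < 1 + r * t" using ra a by (simp add: add_pos_nonneg)
      then show "((\<lambda>t. r\<^sup>2 * t / (1 + r * t)) has_real_derivative (r / (1 + r * t))\<^sup>2) (at t)"
        by (auto intro!: derivative_eq_intros simp: power2_eq_square)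
          (simp add: field_simps)
      show "((\<lambda>t. v \<bullet> gradient f (w + t *\<^sub>R v)) has_real_derivative
          v \<bullet> hessian f (w + t *\<^sub>R v) v) (at t)"
        using line_derivs(2)[OF int] t by simp
      have "r / (1 + r * t) \<le> local_norm f (w + t *\<^sub>R v) v"
        using local_norm_along_line(1)[OF t(1) int] pos
        by (simp add: pos_divide_le_eq r_def mult.commute)
      then have "(r / (1 + r * t))\<^sup>2 \<le> (local_norm f (w + t *\<^sub>R v) v)\<^sup>2"
        using pos ra a by (intro power_mono) auto
      then show "(r / (1 + r * t))\<^sup>2 \<le> v \<bullet> hessian f (w + t *\<^sub>R v) v"
        using local_norm_power2[OF int[OF t(1)]] by simp
    qed
    then show ?thesis
      using inner_gradient_nonpos[OF int[OF T] v] by (simp add: a_def)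
  qed
  \<comment> \<open>Solves \<open>r^2 * T - a * r * T = a + 1\<close>, which overshoots the
    \<open>a\<close> permitted by \<open>bound\<close>.\<close>
  define T where "T = (a + 1) / (r * (r - a))"
  have "0 < r * (r - a)" using ra a by simp
  then have T: "0 \<le> T" "T * (r * (r - a)) = a + 1" using a by (auto simp: T_def)
  have "r\<^sup>2 * T \<le> a * (1 + r * T)"
    using bound[OF T(1)] T(1) ra a by (simp add: pos_divide_le_eq add_pos_nonneg)
  with T(2) show False by (simp add: power2_eq_square algebra_simps)
qed

text \<open>Two integrations of \<open>(r / (1 - r * t))^2\<close>, an upper bound on the curvature:
  first to the slope bound \<open>grad\<close>, then to the logarithm.\<close>

lemma upper_bound_on_segment:
  assumes int: "\<And>t. 0 \<le> t \<Longrightarrow> t \<le> T \<Longrightarrow> w + t *\<^sub>R v \<in> interior C"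
    and T: "0 \<le> T" "T * local_norm f w v < 1"
  shows "f (w + T *\<^sub>R v) \<le> f w + T * (v \<bullet> gradient f w)
           - T * local_norm f w v - ln (1 - T * local_norm f w v)"
proof -
  define r where "r = local_norm f w v"
  define d where "d = v \<bullet> gradient f w"
  have r: "0 \<le> r" using int[of 0] T by (simp add: r_def)
  have pos: "0 < 1 - r * t" if "t \<le> T" for t
    using mult_left_mono[OF that r] T by (simp add: r_def mult.commute)
  have grad: "v \<bullet> gradient f (w + t *\<^sub>R v) \<le> d + r\<^sup>2 * t / (1 - r * t)" if t: "0 \<le> t" "t \<le> T" for t
  proof -
    have "v \<bullet> gradient f (w + t *\<^sub>R v) - v \<bullet> gradient f (w + 0 *\<^sub>R v)
        \<le> r\<^sup>2 * t / (1 - r * t) - r\<^sup>2 * 0 / (1 - r * 0)"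
    proof (rule diff_le_of_derivative_le[OF t(1)])
      fix s assume s: "0 \<le> s" "s \<le> t"
      then have s': "s \<le> T" using t by simp
      show "((\<lambda>s. r\<^sup>2 * s / (1 - r * s)) has_real_derivative (r / (1 - r * s))\<^sup>2) (at s)"
        using pos[OF s'] by (auto intro!: derivative_eq_intros simp: power2_eq_square)
          (simp add: field_simps)
      show "((\<lambda>s. v \<bullet> gradient f (w + s *\<^sub>R v)) has_real_derivative
          v \<bullet> hessian f (w + s *\<^sub>R v) v) (at s)"
        using line_derivs(2)[OF int] s s' by simp
      have "local_norm f (w + s *\<^sub>R v) v \<le> r / (1 - r * s)"
        using local_norm_along_line(2)[OF s(1) int] pos[OF s'] s'
        by (simp add: pos_le_divide_eq r_def mult.commute)
      then have "(local_norm f (w + s *\<^sub>R v) v)\<^sup>2 \<le> (r / (1 - r * s))\<^sup>2"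
        using int[OF s(1) s'] by (intro power_mono) auto
      then show "v \<bullet> hessian f (w + s *\<^sub>R v) v \<le> (r / (1 - r * s))\<^sup>2"
        using local_norm_power2[OF int[OF s(1) s']] by simp
    qed
    then show ?thesis by (simp add: d_def)
  qed
  let ?H = "\<lambda>t. t * d - t * r - ln (1 - t * r)"
  have "f (w + T *\<^sub>R v) - f (w + 0 *\<^sub>R v) \<le> ?H T - ?H 0"
  proof (rule diff_le_of_derivative_le[OF T(1)])
    fix t assume t: "0 \<le> t" "t \<le> T"
    show "((\<lambda>t. f (w + t *\<^sub>R v)) has_real_derivative v \<bullet> gradient f (w + t *\<^sub>R v)) (at t)"
      using line_derivs(1)[OF int[OF t]] .
    have "(?H has_real_derivative d - r + r / (1 - t * r)) (at t)"
      using pos[OF t(2)] by (auto intro!: derivative_eq_intros simp: mult.commute)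
    moreover have "d - r + r / (1 - t * r) = d + r\<^sup>2 * t / (1 - r * t)"
      using pos[OF t(2)] by (simp add: field_simps power2_eq_square)
    ultimately show "(?H has_real_derivative d + r\<^sup>2 * t / (1 - r * t)) (at t)" by simp
  qed (use grad in auto)
  then show ?thesis by (simp add: r_def d_def)
qed

text \<open>Extends the segment bound to an endpoint known only to lie in \<open>C\<close>. Were it
  on the frontier, \<open>f\<close> would blow up along the segment, but the segment bound keeps it
  bounded while the local norm is below 1.\<close>

lemma upper_bound:
  assumes w: "w \<in> interior C" and v: "w + v \<in> C" and r: "local_norm f w v < 1"
  shows "w + v \<in> interior C"
    and "f (w + v) \<le> f w + v \<bullet> gradient f w - local_norm f w v - ln (1 - local_norm f w v)"
proof -
  define r d where "r = local_norm f w v" and "d = v \<bullet> gradient f w"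
  have r: "0 \<le> r" "r < 1" using w r by (auto simp: r_def)
  show int: "w + v \<in> interior C"
  proof (rule ccontr)
    assume "w + v \<notin> interior C"
    with v have front: "w + v \<in> frontier C"
      using closure_subset by (auto simp: frontier_def)
    define t where "t i = 1 - inverse (real (Suc i))" for i :: nat
    have t: "0 \<le> t i" "t i < 1" for i by (auto simp: t_def field_simps)
    have int: "w + t i *\<^sub>R v \<in> interior C" for i
      using segment_interior[OF w v] t by blast
    have "t \<longlonglongrightarrow> 1 - 0"
      unfolding t_def by (intro tendsto_diff tendsto_const LIMSEQ_inverse_real_of_nat)
    then have "(\<lambda>i. w + t i *\<^sub>R v) \<longlonglongrightarrow> w + v"
      by (auto intro!: tendsto_eq_intros)
    then have lim: "filterlim (\<lambda>i. f (w + t i *\<^sub>R v)) at_top sequentially"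
      using front int by (intro filterlim_barrier)
    \<comment> \<open>A bound uniform in \<open>i\<close>, to contradict divergence to
      infinity.\<close>
    have "f (w + t i *\<^sub>R v) \<le> f w + \<bar>d\<bar> - ln (1 - r)" for i
    proof -
      have tr: "0 \<le> t i * r" "t i * r \<le> r" 
        using t[of i] r by (auto simp: mult_left_le_one_le)
      then have "f (w + t i *\<^sub>R v) \<le> f w + t i * d - t i * r - ln (1 - t i * r)"
        unfolding r_def d_def using r t[of i]
        by (intro upper_bound_on_segment segment_interior[OF w v]) (auto simp: r_def)
      moreover have "t i * d \<le> \<bar>d\<bar>"
        using t[of i] mult_left_le_one_le[of "\<bar>d\<bar>" "t i"] by (smt (verit) abs_ge_self mult_left_mono abs_ge_zero)
      moreover have "ln (1 - r) \<le> ln (1 - t i * r)"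
        using tr r by (subst ln_le_cancel_iff) auto
      ultimately show ?thesis using tr by linarith
    qed
    moreover have "eventually (\<lambda>i. f w + \<bar>d\<bar> - ln (1 - r) < f (w + t i *\<^sub>R v)) sequentially"
      using lim unfolding filterlim_at_top_dense by blast
    then obtain i where "f w + \<bar>d\<bar> - ln (1 - r) < f (w + t i *\<^sub>R v)"
      using eventually_happens'[OF sequentially_bot] by blast
    ultimately show False by (meson not_less)
  qed
  have "w + t *\<^sub>R v \<in> interior C" if "0 \<le> t" "t \<le> 1" for t
    using segment_interior[OF w v] int that by (cases "t = 1") auto
  from upper_bound_on_segment[OF this, of 1] r show
    "f (w + v) \<le> f w + v \<bullet> gradient f w - local_norm f w v - ln (1 - local_norm f w v)"
    by (simp add: r_def)
qed

text \<open>The identities for the Hessian turn the square of the left-hand side into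
  \<open>\<parallel>v\<parallel>\<^sup>2 - 2 a + \<theta>\<close> with \<open>a = - \<langle>\<nabla>f(w), v\<rangle> \<ge> \<parallel>v\<parallel>\<close>.\<close>

lemma local_norm_diff_le:
  assumes w: "w \<in> interior C" and v: "v \<in> C"
    and b: "- (v \<bullet> gradient f w) \<le> b" "\<theta> \<le> b"
  shows "local_norm f w (v - w) \<le> b"
proof (rule power2_le_imp_le)
  define a where "a = - (v \<bullet> gradient f w)"
  have a: "0 \<le> a" "a \<le> b" using inner_gradient_nonpos[OF w v] b by (auto simp: a_def)
  have "(local_norm f w (v - w))\<^sup>2 = (local_norm f w v)\<^sup>2 - 2 * a + \<theta>"
    using w by (simp add: local_norm_power2 linear_diff[OF linear_hessian] inner_diff_left inner_diff_right inner_add_right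
      inner_hessian_self hessian_self inner_gradient_self a_def)
  also have "(local_norm f w v)\<^sup>2 \<le> a\<^sup>2"
    using local_norm_le_inner_gradient[OF w v] w by (intro power_mono) (auto simp: a_def)
  also have "a\<^sup>2 - 2 * a + \<theta> \<le> b\<^sup>2"
  proof -
    \<comment> \<open>The right-hand side is \<open>b^2 - b\<close>, which leaves room for
      \<open>\<theta> \<le> b\<close>.\<close>
    have "a * (a - 2) \<le> b * (b - 1)"
    proof (cases "a \<le> 2")
      case True
      then have "a * (a - 2) \<le> 0" using a by (simp add: mult_nonneg_nonpos)
      also have "0 \<le> b * (b - 1)" using b theta_ge_1 by simp
      finally show ?thesis .
    next
      case False
      then show ?thesis using a by (intro mult_mono) auto
    qed
    then show ?thesis using b by (simp add: power2_eq_square algebra_simps)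
  qed
  finally show "(local_norm f w (v - w))\<^sup>2 \<le> b\<^sup>2" by simp
  show "0 \<le> b" using a by simp
qed

text \<open>Here \<open>G\<close> need not be the slope of \<open>f\<close>: the discrepancy
  \<open>(v - w) \<bullet> gradient f w + G\<close> is kept as an error term, to be offset by the
  nonsmooth part.\<close>

lemma barrier_decrease:
  assumes w: "w \<in> interior C" and v: "v \<in> C" and G: "0 \<le> G"
    and M: "\<theta> \<le> M" "- (v \<bullet> gradient f w) \<le> G + M"
  defines "\<gamma> \<equiv> step_size G (local_norm f w (v - w))"
  shows "0 \<le> \<gamma>" "\<gamma> \<le> 1" "(1 - \<gamma>) *\<^sub>R w + \<gamma> *\<^sub>R v \<in> interior C"
    and "f ((1 - \<gamma>) *\<^sub>R w + \<gamma> *\<^sub>R v) \<le> f w + \<gamma> * ((v - w) \<bullet> gradient f w + G)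
           - (if M < G then 1 / 10.6 else G\<^sup>2 / (12 * M\<^sup>2))"
proof -
  define D where "D = local_norm f w (v - w)"
  have D: "0 \<le> D" "D \<le> G + M"
    using local_norm_diff_le[OF w v M(2)] w G M by (auto simp: D_def)
  note step = step_size_decrease[OF G D, unfolded D_def, folded \<gamma>_def]
  have M1: "1 \<le> M" using M theta_ge_1 by simp
  show \<gamma>: "0 \<le> \<gamma>" "\<gamma> \<le> 1" using step M1 by auto
  have pt: "(1 - \<gamma>) *\<^sub>R w + \<gamma> *\<^sub>R v = w + \<gamma> *\<^sub>R (v - w)" by (simp add: algebra_simps)
  have "(1 - \<gamma>) *\<^sub>R w + \<gamma> *\<^sub>R v \<in> C"
    using convex_cone(1) w v \<gamma> interior_subset[of C] unfolding convex_alt by blast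
  then have mem: "w + \<gamma> *\<^sub>R (v - w) \<in> C" by (simp add: pt)
  have norm: "local_norm f w (\<gamma> *\<^sub>R (v - w)) = \<gamma> * D"
    using local_norm_scaleR[OF w \<gamma>(1)] by (simp add: D_def)
  have "local_norm f w (\<gamma> *\<^sub>R (v - w)) < 1" using step(3)[OF M1] by (simp add: norm D_def)
  note ub = upper_bound[OF w mem this]
  show "(1 - \<gamma>) *\<^sub>R w + \<gamma> *\<^sub>R v \<in> interior C" using ub(1) by (simp add: pt)
  show "f ((1 - \<gamma>) *\<^sub>R w + \<gamma> *\<^sub>R v) \<le> f w + \<gamma> * ((v - w) \<bullet> gradient f w + G)
           - (if M < G then 1 / 10.6 else G\<^sup>2 / (12 * M\<^sup>2))"
    using ub(2) step(4)[OF M1] unfolding pt norm D_def[symmetric]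
    by (simp add: distrib_left)
qed

end

section \<open>The Frank-Wolfe iteration\<close>

lemma edom_real:
  assumes "proper_fun g" "x \<in> edom g"
  shows "g x = ereal (real_of_ereal (g x))"
  using assms by (auto simp: proper_fun_def edom_def ereal_real)

lemma convex_fun_le:
  assumes g: "proper_fun g" "convex_fun g" and xy: "x \<in> edom g" "y \<in> edom g" and u: "0 \<le> u" "u \<le> 1"
  shows "(1 - u) *\<^sub>R x + u *\<^sub>R y \<in> edom g"
    and "real_of_ereal (g ((1 - u) *\<^sub>R x + u *\<^sub>R y))
      \<le> (1 - u) * real_of_ereal (g x) + u * real_of_ereal (g y)"
proof -
  define z where "z = (1 - u) *\<^sub>R x + u *\<^sub>R y"
  have "(x, real_of_ereal (g x)) \<in> eepigraph g" "(y, real_of_ereal (g y)) \<in> eepigraph g"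
    using edom_real[OF g(1)] xy by (auto simp: eepigraph_def)
  then have "(1 - u) *\<^sub>R (x, real_of_ereal (g x)) + u *\<^sub>R (y, real_of_ereal (g y)) \<in> eepigraph g"
    using g(2) u unfolding convex_fun_def convex_alt by blast
  then have le: "g z \<le> ereal ((1 - u) * real_of_ereal (g x) + u * real_of_ereal (g y))"
    by (simp add: eepigraph_def z_def)
  then show z: "z \<in> edom g" by (auto simp: edom_def)
  show "real_of_ereal (g z) \<le> (1 - u) * real_of_ereal (g x) + u * real_of_ereal (g y)"
    using le by (subst (asm) edom_real[OF g(1) z]) simp
qed

lemma diff_le_osc:
  assumes "proper_fun g" "osc g = ereal R" "x \<in> edom g" "y \<in> edom g"
  shows "real_of_ereal (g x) - real_of_ereal (g y) \<le> R"
proof -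
  have "\<bar>g x - g y\<bar> \<le> osc g"
    unfolding osc_def using assms by (intro SUP_upper2[of x] SUP_upper2[of y]) auto
  then have "\<bar>ereal (real_of_ereal (g x)) - ereal (real_of_ereal (g y))\<bar> \<le> ereal R"
    using assms edom_real[OF assms(1)] by simp
  then show ?thesis by simp
qed

locale generalized_frank_wolfe = log_homogeneous_barrier C f \<theta>
  for C :: "'b::euclidean_space set" and f \<theta> +
  fixes B :: "'a::euclidean_space \<Rightarrow> 'b" and g :: "'a \<Rightarrow> ereal" and R :: real and xs :: 'a
  assumes lin: "linear B"
    and proper: "proper_fun g" and conv: "convex_fun g"
    and R: "osc g = ereal R"
    and minimizer: "is_arg_min (objective C f B g) (\<lambda>_. True) xs"
begin

abbreviation gr :: "'a \<Rightarrow> real" where "gr x \<equiv> real_of_ereal (g x)"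

text \<open>A real-valued \<open>objective\<close>, faithful exactly at feasible points; elsewhere
  \<open>objective\<close> is infinite.\<close>

definition F :: "'a \<Rightarrow> real" where "F x = f (B x) + gr x"

lemma objective_feasible: "feasible C B g x \<Longrightarrow> objective C f B g x = ereal (F x)"
  using edom_real[OF proper, of x] by (simp add: feasible_def objective_def F_def) (metis plus_ereal.simps(1))

lemma minimizer_le: "objective C f B g xs \<le> objective C f B g x"
  using minimizer by (auto simp: is_arg_min_def not_less)

lemma feasible_minimizer:
  assumes "feasible C B g x"
  shows "feasible C B g xs"
proof -
  have "objective C f B g xs \<le> ereal (F x)"
    using minimizer_le[of x] objective_feasible[OF assms] by simp
  moreover have "g xs \<noteq> - \<infinity>" using proper by (simp add: proper_fun_def)
  ultimately show ?thesis
    by (cases "g xs") (auto simp: feasible_def objective_def edom_def split: if_splits)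
qed

lemma F_minimizer_le:
  assumes "feasible C B g x"
  shows "F xs \<le> F x"
  using minimizer_le[of x] objective_feasible[OF assms]
    objective_feasible[OF feasible_minimizer[OF assms]] by simp

lemma lin_objective_edom:
  assumes "y \<in> edom g"
  shows "lin_objective f B g x y = ereal (B y \<bullet> gradient f (B x) + gr y)"
  using edom_real[OF proper assms]
  by (simp add: lin_objective_def adjoint_clauses[OF lin] inner_commute) (metis plus_ereal.simps(1))

section \<open>A single oracle call\<close>

context
  fixes x h :: 'a and \<delta> G :: real
  assumes x: "feasible C B g x" and oracle_call: "ilmo C f \<theta> B g R x \<delta> h G"
begin

lemma oracle_gap: "G = (B x - B h) \<bullet> gradient f (B x) + gr x - gr h"
  using oracle_call x lin_objective_edom[of x x] lin_objective_edom[of h x]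
  by (simp add: ilmo_def feasible_def inner_diff_left)

lemma oracle_step:
  defines "\<gamma> \<equiv> step_size G (local_norm f (B x) (B (h - x)))"
  shows "feasible C B g ((1 - \<gamma>) *\<^sub>R x + \<gamma> *\<^sub>R h)"
    and "F ((1 - \<gamma>) *\<^sub>R x + \<gamma> *\<^sub>R h)
      \<le> F x - (if \<theta> + R < G then 1 / 10.6 else G\<^sup>2 / (12 * (\<theta> + R)\<^sup>2))"
proof -
  have h: "h \<in> edom g" "B h \<in> C" "0 \<le> G" using oracle_call by (auto simp: ilmo_def)
  have x': "x \<in> edom g" "B x \<in> interior C" using x by (auto simp: feasible_def)
  have "0 \<le> R" using diff_le_osc[OF proper R x'(1) x'(1)] by simp
  then have M: "\<theta> \<le> \<theta> + R" by simp
  \<comment> \<open>The reason for \<open>M = \<theta> + R\<close>: by the gap identity the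
    left-hand side is \<open>G + \<theta>\<close> plus \<open>gr h - gr x\<close>.\<close>
  have ray: "- (B h \<bullet> gradient f (B x)) \<le> G + (\<theta> + R)"
    using oracle_gap diff_le_osc[OF proper R h(1) x'(1)] inner_gradient_self[OF x'(2)]
    by (simp add: inner_diff_left)
  have \<gamma>_def': "\<gamma> = step_size G (local_norm f (B x) (B h - B x))"
    by (simp add: \<gamma>_def linear_diff[OF lin])
  note dec = barrier_decrease[OF x'(2) h(2,3) M ray, folded \<gamma>_def']
  have B: "B ((1 - \<gamma>) *\<^sub>R x + \<gamma> *\<^sub>R h) = (1 - \<gamma>) *\<^sub>R B x + \<gamma> *\<^sub>R B h"
    by (simp add: linear_add[OF lin] linear_cmul[OF lin])
  note conv_g = convex_fun_le[OF proper conv x'(1) h(1) dec(1,2)]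
  show "feasible C B g ((1 - \<gamma>) *\<^sub>R x + \<gamma> *\<^sub>R h)"
    using conv_g(1) dec(3) by (simp add: feasible_def B)
  \<comment> \<open>The error term of \<open>barrier_decrease\<close> becomes
    \<open>gr x - gr h\<close>, which convexity of \<open>g\<close> along the step offsets.\<close>
  have "(B h - B x) \<bullet> gradient f (B x) + G = gr x - gr h"
    using oracle_gap by (simp add: inner_diff_left)
  with dec(4) conv_g(2)
  show "F ((1 - \<gamma>) *\<^sub>R x + \<gamma> *\<^sub>R h)
      \<le> F x - (if \<theta> + R < G then 1 / 10.6 else G\<^sup>2 / (12 * (\<theta> + R)\<^sup>2))"
    unfolding F_def B by (simp only: left_diff_distrib right_diff_distrib mult_1)
qed

text \<open>A gap of at most \<open>\<theta> + R\<close> forces the suboptimality alternative.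
  Comparing \<open>h\<close> with \<open>xs\<close> through the linear minimizer and bounding
  \<open>f\<close> below by its tangent gives the claim.\<close>

lemma oracle_gap_bound:
  assumes "G \<le> \<theta> + R"
  shows "F x - F xs \<le> G + \<delta>"
proof -
  have x': "x \<in> edom g" "B x \<in> interior C" using x by (auto simp: feasible_def)
  have xs: "xs \<in> edom g" "B xs \<in> interior C"
    using feasible_minimizer[OF x] by (auto simp: feasible_def)
  have h: "h \<in> edom g" using oracle_call by (auto simp: ilmo_def)
  obtain hs where hs: "is_arg_min (lin_objective f B g x) (\<lambda>_. True) hs"
      "lin_objective f B g x h \<le> lin_objective f B g x hs + ereal \<delta>"
    using oracle_call assms by (auto simp: ilmo_def)
  from hs(2) have "lin_objective f B g x h \<le> lin_objective f B g x xs + ereal \<delta>"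
    using hs(1) by (elim order_trans) (auto simp: is_arg_min_def not_less intro!: add_right_mono)
  then have "B h \<bullet> gradient f (B x) + gr h \<le> B xs \<bullet> gradient f (B x) + gr xs + \<delta>"
    by (simp add: lin_objective_edom h xs)
  then show ?thesis
    using gradient_inequality[OF x'(2) xs(2)] oracle_gap
    by (simp add: F_def inner_diff_left)
qed

end

section \<open>The run of the algorithm\<close>

context
  fixes \<epsilon> :: real and \<delta> G :: "nat \<Rightarrow> real" and x h :: "nat \<Rightarrow> 'a"
  assumes eps: "0 < \<epsilon>" "\<epsilon> \<le> \<theta> + R"
    and run: "agfw_run C f \<theta> B g R \<epsilon> \<delta> x h G"
    and delta: "\<And>t. executed \<epsilon> G \<delta> t \<Longrightarrow>
                  ereal (\<delta> t) \<le> ereal (\<epsilon> / 2) + (INF \<tau>\<in>{..<t}. ereal (G \<tau>))"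
begin

lemma executed_Suc: "executed \<epsilon> G \<delta> (Suc t) \<longleftrightarrow> executed \<epsilon> G \<delta> t \<and> \<not> stop_test \<epsilon> (G t) (\<delta> t)"
  by (auto simp: executed_def less_Suc_eq)

lemma run_oracle: "executed \<epsilon> G \<delta> t \<Longrightarrow> ilmo C f \<theta> B g R (x t) (\<delta> t) (h t) (G t)"
  using run by (simp add: agfw_run_def)

lemma run_update:
  assumes "executed \<epsilon> G \<delta> (Suc t)"
  shows "x (Suc t) = (1 - step_size (G t) (local_norm f (B (x t)) (B (h t - x t)))) *\<^sub>R x t
           + step_size (G t) (local_norm f (B (x t)) (B (h t - x t))) *\<^sub>R h t"
  using run assms by (simp add: agfw_run_def executed_Suc Let_def)

lemma run_feasible: "executed \<epsilon> G \<delta> t \<Longrightarrow> feasible C B g (x t)"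
proof (induction t)
  case 0
  then show ?case using run by (simp add: agfw_run_def)
next
  case (Suc t)
  then have "executed \<epsilon> G \<delta> t" by (simp add: executed_Suc)
  with Suc.IH run_oracle show ?case
    unfolding run_update[OF Suc.prems] by (intro oracle_step(1)) auto
qed

lemma executed_count:
  assumes "executed \<epsilon> G \<delta> T"
  shows "real T \<le> 10.6 * (F (x 0) - F xs) + 84 * (\<theta> + R)\<^sup>2 / \<epsilon> + log 2 ((\<theta> + R) / \<epsilon>) + 2"
proof (rule iteration_count[OF eps, where G = G and \<delta> = \<delta> and \<Delta> = "\<lambda>t. F (x t) - F xs"])
  have ex: "executed \<epsilon> G \<delta> t" if "t \<le> T" for t
    using assms that by (auto simp: executed_def)
  show "0 \<le> F (x t) - F xs" if "t \<le> T" for t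
    using F_minimizer_le[OF run_feasible[OF ex[OF that]]] by simp
  fix t assume t: "t < T"
  then have ext: "executed \<epsilon> G \<delta> t" "executed \<epsilon> G \<delta> (Suc t)" using ex by auto
  show "\<not> stop_test \<epsilon> (G t) (\<delta> t)" using assms t by (simp add: executed_def)
  note feas = run_feasible[OF ext(1)] and orc = run_oracle[OF ext(1)]
  note step = oracle_step(2)[OF feas orc, folded run_update[OF ext(2)]]
  show "F (x (Suc t)) - F xs \<le> F (x t) - F xs - 1 / 10.6" if "\<theta> + R < G t"
    using step that by simp
  show "F (x (Suc t)) - F xs \<le> F (x t) - F xs - (G t)\<^sup>2 / (12 * (\<theta> + R)\<^sup>2)" if "G t \<le> \<theta> + R"
    using step that by simp
  show "F (x t) - F xs \<le> G t + \<delta> t" if "G t \<le> \<theta> + R"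
    using oracle_gap_bound[OF feas orc that] .
  fix s assume "s < t"
  \<comment> \<open>The infimum lies below every earlier gap; at \<open>t = 0\<close> it is infinite
    and there is no such \<open>s\<close>.\<close>
  then have "(INF \<tau>\<in>{..<t}. ereal (G \<tau>)) \<le> ereal (G s)" by (intro INF_lower) simp
  then have "ereal (\<delta> t) \<le> ereal (\<epsilon> / 2) + ereal (G s)"
    using delta[OF ext(1)] by (meson add_left_mono order_trans)
  then show "\<delta> t \<le> \<epsilon> / 2 + G s" by simp
qed

text \<open>The count rules out an endless run; the least stopping index is executed because nothing
  stopped before it.\<close>

lemma stopping_time:
  obtains K where "executed \<epsilon> G \<delta> K" "stop_test \<epsilon> (G K) (\<delta> K)"
proof -
  have "\<not> (\<forall>T. executed \<epsilon> G \<delta> T)"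
  proof
    assume "\<forall>T. executed \<epsilon> G \<delta> T"
    then have "real T \<le> 10.6 * (F (x 0) - F xs) + 84 * (\<theta> + R)\<^sup>2 / \<epsilon> + log 2 ((\<theta> + R) / \<epsilon>) + 2" for T
      using executed_count by blast
    then show False by (meson not_less reals_Archimedean2)
  qed
  then have "\<exists>t. stop_test \<epsilon> (G t) (\<delta> t)" by (auto simp: executed_def)
  then have "stop_test \<epsilon> (G (LEAST t. stop_test \<epsilon> (G t) (\<delta> t))) (\<delta> (LEAST t. stop_test \<epsilon> (G t) (\<delta> t)))"
    by (rule LeastI_ex)
  with that show ?thesis by (meson executed_def not_less_Least)
qed

end

end

theorem lemma6:
  fixes C :: "(real ^ 'd) set" and f :: "real ^ 'd \<Rightarrow> real" and \<theta> :: real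
    and B :: "real ^ 'n \<Rightarrow> real ^ 'd" and g :: "real ^ 'n \<Rightarrow> ereal" and R :: real
    and xs :: "real ^ 'n" and \<epsilon> :: real and \<delta> :: "nat \<Rightarrow> real"
    and x h :: "nat \<Rightarrow> real ^ 'n" and G :: "nat \<Rightarrow> real"
  assumes cone: "proper_cone C"
    and barrier: "sc_log_homogeneous_barrier C \<theta> f"
    and lin: "linear B"
    and g: "proper_fun g" "closed_fun g" "convex_fun g" "compact (edom g)"
    and inter: "interior C \<inter> B ` edom g \<noteq> {}"
    and R: "osc g = ereal R"
    and xs: "is_arg_min (objective C f B g) (\<lambda>_. True) xs"
    and eps: "0 < \<epsilon>" "\<epsilon> \<le> \<theta> + R"
    and delta_nonneg: "\<And>t. 0 \<le> \<delta> t"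
    and run: "agfw_run C f \<theta> B g R \<epsilon> \<delta> x h G"
    and delta: "\<And>t. executed \<epsilon> G \<delta> t \<Longrightarrow>
                  ereal (\<delta> t) \<le> ereal (\<epsilon> / 2) + (INF \<tau>\<in>{..<t}. ereal (G \<tau>))"
  shows "\<exists>K. int K \<le> \<lfloor>10.6 * real_of_ereal (objective C f B g (x 0) - objective C f B g xs)\<rfloor>
                   + 2 * \<lceil>72 * (\<theta> + R)\<^sup>2 / \<epsilon>\<rceil>
                   + (2 + \<lceil>log 2 ((\<theta> + R) / \<epsilon>)\<rceil>) \<and>
             executed \<epsilon> G \<delta> K \<and>
             objective C f B g (x K) - objective C f B g xs \<le> ereal (5 * \<epsilon> / 2) \<and>
             G K \<le> \<epsilon> \<and>
             \<delta> K \<le> 3 * \<epsilon> / 2"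
proof -
  interpret generalized_frank_wolfe C f \<theta> B g R xs
    using cone barrier lin g R xs
    by (intro generalized_frank_wolfe.intro log_homogeneous_barrier.intro generalized_frank_wolfe_axioms.intro)
  obtain K where K: "executed \<epsilon> G \<delta> K" "stop_test \<epsilon> (G K) (\<delta> K)"
    using stopping_time[OF eps run delta] by blast
  have stop: "G K \<le> \<epsilon>" "\<delta> K \<le> 3 * \<epsilon> / 2" using K(2) by (auto simp: stop_test_def)
  have feas: "feasible C B g (x K)" "feasible C B g (x 0)"
    using run_feasible[OF eps run delta] K(1) by (auto simp: executed_def)
  have obj: "objective C f B g xs = ereal (F xs)"
    by (rule objective_feasible[OF feasible_minimizer[OF feas(2)]])
  define M where "M = \<theta> + R"
  have "1 \<le> M"
    using theta_ge_1 diff_le_osc[OF g(1) R, of xs xs] feasible_minimizer[OF feas(2)]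
    by (simp add: M_def feasible_def)
  then have "\<epsilon> * 1 \<le> M * M" using eps by (intro mult_mono) (auto simp: M_def)
  \<comment> \<open>Rounding \<open>10.6 * (F (x 0) - F xs)\<close> down loses less than 1, which
    the surplus \<open>60 * M^2 / \<epsilon>\<close> covers.\<close>
  then have slack: "1 \<le> M\<^sup>2 / \<epsilon>" using eps by (simp add: power2_eq_square)
  have "real K \<le> 10.6 * (F (x 0) - F xs) + 84 * M\<^sup>2 / \<epsilon> + log 2 (M / \<epsilon>) + 2"
    using executed_count[OF eps run delta K(1)] by (simp add: M_def)
  also have "\<dots> \<le> real_of_int (\<lfloor>10.6 * (F (x 0) - F xs)\<rfloor> + 2 * \<lceil>72 * M\<^sup>2 / \<epsilon>\<rceil> + (2 + \<lceil>log 2 (M / \<epsilon>)\<rceil>))"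
    using slack by linarith
  finally have "int K \<le> \<lfloor>10.6 * (F (x 0) - F xs)\<rfloor> + 2 * \<lceil>72 * M\<^sup>2 / \<epsilon>\<rceil> + (2 + \<lceil>log 2 (M / \<epsilon>)\<rceil>)"
    by linarith
  \<comment> \<open>At the stopping index \<open>G K \<le> \<epsilon> \<le> \<theta> + R\<close>, so
    the gap bound applies and adds \<open>\<epsilon>\<close> and
    \<open>3 * \<epsilon> / 2\<close>.\<close>
  moreover have "F (x K) - F xs \<le> 5 * \<epsilon> / 2"
    using oracle_gap_bound[OF feas(1) run_oracle[OF eps run delta K(1)]] stop eps by simp
  ultimately show ?thesis
    using K(1) stop objective_feasible[OF feas(1)] objective_feasible[OF feas(2)] obj
    by (intro exI[of _ K]) (simp add: M_def)
qed

end
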